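(* Let $s\ge 2$, $t\ge 2$ and $n=s+t$. The graph $K^{s+t}_{n}$ is determined by its $D$-spectrum: every connected graph $D$-cospectral to $K^{s+t}_{n}$ is isomorphic to $K^{s+t}_{n}$.
   Context: All graphs are simple, undirected and connected. For a connected graph $G$, the distance matrix $D(G)$ has as $(i,j)$-entry the distance between the $i$-th and $j$-th vertices; its eigenvalues form the $D$-spectrum of $G$. Two graphs are $D$-cospectral if they have the same $D$-spectrum; $G$ is determined by its $D$-spectrum if every graph $D$-cospectral to $G$ is isomorphic to $G$. $K^{s+t}_{n}$ denotes the graph obtained from disjoint copies of $K_s$ and $K_t$ by adding one edge joining a vertex of $K_s$ to a vertex of $K_t$. *)

theory Defs
  imports "Jordan_Normal_Form.Char_Poly"
begin

definition simple_graph :: "nat \<Rightarrow> (nat \<Rightarrow> nat \<Rightarrow> bool) \<Rightarrow> bool" where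
  "simple_graph n E \<longleftrightarrow> (\<forall>i j. E i j \<longrightarrow> i < n \<and> j < n \<and> i \<noteq> j \<and> E j i)"

definition connected_graph :: "nat \<Rightarrow> (nat \<Rightarrow> nat \<Rightarrow> bool) \<Rightarrow> bool" where
  "connected_graph n E \<longleftrightarrow> 0 < n \<and> (\<forall>i<n. \<forall>j<n. \<exists>k. (E ^^ k) i j)"

definition gdist :: "(nat \<Rightarrow> nat \<Rightarrow> bool) \<Rightarrow> nat \<Rightarrow> nat \<Rightarrow> nat" where
  "gdist E i j = (LEAST k. (E ^^ k) i j)"

definition distance_matrix :: "nat \<Rightarrow> (nat \<Rightarrow> nat \<Rightarrow> bool) \<Rightarrow> real mat" where
  "distance_matrix n E = mat n n (\<lambda>(i, j). real (gdist E i j))"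

definition D_spectrum :: "nat \<Rightarrow> (nat \<Rightarrow> nat \<Rightarrow> bool) \<Rightarrow> complex multiset" where
  "D_spectrum n E = proots (map_poly complex_of_real (char_poly (distance_matrix n E)))"

definition graph_iso :: "nat \<Rightarrow> (nat \<Rightarrow> nat \<Rightarrow> bool) \<Rightarrow> nat \<Rightarrow> (nat \<Rightarrow> nat \<Rightarrow> bool) \<Rightarrow> bool" where
  "graph_iso n E m F \<longleftrightarrow> (\<exists>f. bij_betw f {..<n} {..<m} \<and>
      (\<forall>i<n. \<forall>j<n. E i j \<longleftrightarrow> F (f i) (f j)))"

definition Kst :: "nat \<Rightarrow> nat \<Rightarrow> nat \<Rightarrow> nat \<Rightarrow> bool" where
  "Kst s t i j \<longleftrightarrow> i < s + t \<and> j < s + t \<and> i \<noteq> j \<and>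
     ((i < s \<and> j < s) \<or> (s \<le> i \<and> s \<le> j) \<or> (i = 0 \<and> j = s) \<or> (i = s \<and> j = 0))"

end

theory Submission
  imports Defs "Jordan_Normal_Form.Jordan_Normal_Form_Uniqueness"
    "Jordan_Normal_Form.Jordan_Normal_Form_Existence"
begin

text \<open>
  Let \<open>D\<close> be the distance matrix of a graph that is cospectral to \<open>K\<^sup>s\<^sup>+\<^sup>t\<close>. The matrix \<open>D + I\<close> of
  \<open>K\<^sup>s\<^sup>+\<^sup>t\<close> is a blow-up of the one of the path \<open>P\<^sub>4\<close> with class sizes \<open>s - 1, 1, 1, t - 1\<close>, so \<open>-1\<close> has
  multiplicity at least \<open>n - 4\<close>, and since \<open>D\<close> is symmetric, any five columns of \<open>D + I\<close> are linearly
  dependent. Hence four vertices with a nonsingular principal submatrix \<open>S\<close> determine everything: the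
  distances \<open>v\<close> of a further vertex to these four satisfy \<open>v\<^sup>T S\<^sup>-\<^sup>1 v = 1\<close>, which for the matrices
  occurring here forces \<open>v\<close> to be a row of \<open>S\<close>, so the vertex is a twin of one of the four.

  If the diameter is at least 3, this applies to an isometric \<open>P\<^sub>4\<close> and the graph is a blow-up of \<open>P\<^sub>4\<close>.
  If it is at most 2, then induced \<open>P\<^sub>4\<close> and \<open>P\<^sub>3 + K\<^sub>1\<close> are impossible because two of their vertices
  at distance 2 would lack a common neighbour, and the graph is a blow-up of \<open>C\<^sub>4\<close> or \<open>K\<^sub>1\<^sub>,\<^sub>3\<close>.
  A blow-up has, up to powers of \<open>x + 1\<close>, the characteristic polynomial of its quotient, a quartic;
  comparing its coefficients excludes the last two graphs and determines the class sizes in the first.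
\<close>

section \<open>Linear algebra\<close>

text \<open>Sylvester's determinant identity. Multiplying the block matrix \<open>?M\<close> by
  \<open>?R\<close> on the right or by \<open>?L\<close> on the left clears its lower left block,
  which leaves \<open>P * C\<close> in one corner or \<open>C * P\<close> in the other. The powers
  of \<open>x\<close> on both sides replace a division, so \<open>x = 0\<close> is covered.\<close>

lemma det_smult_one_minus_mult_commute:
  fixes P C :: "'a :: idom mat"
  assumes P: "P \<in> carrier_mat n k" and C: "C \<in> carrier_mat k n"
  shows "x ^ k * det (x \<cdot>\<^sub>m 1\<^sub>m n - P * C) = x ^ n * det (x \<cdot>\<^sub>m 1\<^sub>m k - C * P)"
proof -
  let ?M = "four_block_mat (x \<cdot>\<^sub>m 1\<^sub>m n) P C (1\<^sub>m k)"
  let ?R = "four_block_mat (1\<^sub>m n) (0\<^sub>m n k) (- C) (1\<^sub>m k)"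
  let ?L = "four_block_mat (1\<^sub>m n) (0\<^sub>m n k) (- C) (x \<cdot>\<^sub>m 1\<^sub>m k)"
  have M: "?M \<in> carrier_mat (n + k) (n + k)" and R: "?R \<in> carrier_mat (n + k) (n + k)"
    and L: "?L \<in> carrier_mat (n + k) (n + k)" by (auto intro!: four_block_carrier_mat)
  have "?M * ?R = four_block_mat (x \<cdot>\<^sub>m 1\<^sub>m n - P * C) P (0\<^sub>m k n) (1\<^sub>m k)"
    by (subst mult_four_block_mat[where ?n1.0 = n and ?n2.0 = k and ?nr1.0 = n and ?nr2.0 = k])
       (insert P C, auto intro!: cong_four_block_mat simp: add_uminus_minus_mat)
  then have "det ?M * det ?R = det (x \<cdot>\<^sub>m 1\<^sub>m n - P * C)"
    using P C
    by (simp flip: det_mult[OF M R]) (subst det_four_block_mat_lower_left_zero[of _ n _ k], auto)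
  moreover have "det ?R = 1"
    using C by (subst det_four_block_mat_upper_right_zero[of _ n _ k]) auto
  ultimately have 1: "det ?M = det (x \<cdot>\<^sub>m 1\<^sub>m n - P * C)" by simp
  have "?L * ?M = four_block_mat (x \<cdot>\<^sub>m 1\<^sub>m n) P (0\<^sub>m k n) (x \<cdot>\<^sub>m 1\<^sub>m k - C * P)"
    by (subst mult_four_block_mat[where ?n1.0 = n and ?n2.0 = k and ?nr1.0 = n and ?nr2.0 = k])
       (insert P C, auto intro!: cong_four_block_mat eq_matI simp: mult_smult_distrib[of _ k n _ n] mult_smult_assoc_mat[of _ k k _ n])
  then have "det ?L * det ?M = x ^ n * det (x \<cdot>\<^sub>m 1\<^sub>m k - C * P)"
    using P C
    by (simp flip: det_mult[OF L M])
      (subst det_four_block_mat_lower_left_zero[of _ n _ k], auto simp: det_smult)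
  moreover have "det ?L = x ^ k"
    using C by (subst det_four_block_mat_upper_right_zero[of _ n _ k]) (auto simp: det_smult)
  ultimately show ?thesis using 1 by simp
qed

text \<open>Gaussian elimination, one equation at a time. The index sets are arbitrary because the
  unknowns will be indexed by the vectors of a kernel basis.\<close>

lemma homogeneous_system_nontrivial_solution:
  fixes f :: "'k \<Rightarrow> 'j \<Rightarrow> 'a :: field"
  assumes "finite K" and "finite J" and "card K < card J"
  shows "\<exists>c. (\<exists>j\<in>J. c j \<noteq> 0) \<and> (\<forall>k\<in>K. (\<Sum>j\<in>J. f k j * c j) = 0)"
  using assms
proof (induction K arbitrary: f J rule: finite_induct)
  case empty
  then obtain j where "j \<in> J" by fastforce
  then show ?case by (intro exI[of _ "\<lambda>_. 1"]) auto
next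
  case (insert k K)
  show ?case
  proof (cases "\<forall>j\<in>J. f k j = 0")
    case True
    have "card K < card J" using insert by simp
    from insert.IH[OF \<open>finite J\<close> this] obtain c where "\<exists>j\<in>J. c j \<noteq> 0" "\<forall>k\<in>K. (\<Sum>j\<in>J. f k j * c j) = 0"
      by blast
    with True show ?thesis by (intro exI[of _ c]) auto
  next
    case False
    then obtain i where i: "i \<in> J" "f k i \<noteq> 0" by auto
    \<comment> \<open>Equation \<open>k\<close> is solved for the pivot unknown \<open>i\<close> and
      substituted into the others; \<open>?g\<close> holds the reduced coefficients.\<close>
    let ?J = "J - {i}"
    let ?g = "\<lambda>l j. f l j - f l i * f k j / f k i"
    have "card K < card ?J" using insert i by auto
    then obtain c where c: "\<exists>j\<in>?J. c j \<noteq> 0" "\<forall>l\<in>K. (\<Sum>j\<in>?J. ?g l j * c j) = 0"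
      using insert.IH[of ?J ?g] insert.prems by blast
    define d where "d j = (if j = i then - (\<Sum>j\<in>?J. f k j * c j) / f k i else c j)" for j
    have sum: "(\<Sum>j\<in>J. f l j * d j) = f l i * d i + (\<Sum>j\<in>?J. f l j * c j)" for l
      using insert i by (subst sum.remove[of J i]) (auto simp: d_def intro!: sum.cong)
    have di: "d i = - (\<Sum>j\<in>?J. f k j * c j) / f k i" by (simp add: d_def)
    then have "(\<Sum>j\<in>J. f k j * d j) = 0" unfolding sum using i by simp
    moreover have "(\<Sum>j\<in>J. f l j * d j) = 0" if "l \<in> K" for l
    proof -
      have "(\<Sum>j\<in>?J. ?g l j * c j) = (\<Sum>j\<in>?J. f l j * c j) - f l i / f k i * (\<Sum>j\<in>?J. f k j * c j)"
        by (simp add: sum_subtractf sum_distrib_left algebra_simps)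
      with c(2) that show ?thesis unfolding sum di by simp
    qed
    moreover have "\<exists>j\<in>J. d j \<noteq> 0" using c(1) by (auto simp: d_def)
    ultimately show ?thesis by (intro exI[of _ d]) auto
  qed
qed

section \<open>Eigenspaces of real symmetric matrices\<close>

text \<open>For \<open>w = M v\<close>, symmetry and real entries move one factor \<open>M\<close>
  across the inner product of \<open>w\<close> with itself, so \<open>M (M v) = 0\<close> forces
  \<open>w = 0\<close>; induction does the rest. The matrix is complex because the Jordan normal
  form is taken over a field where the characteristic polynomial splits.\<close>

lemma mat_kernel_pow_symmetric_real:
  fixes M :: "complex mat"
  assumes M: "M \<in> carrier_mat n n"
    and sym: "M\<^sup>T = M" and real: "\<And>i j. i < n \<Longrightarrow> j < n \<Longrightarrow> cnj (M $$ (i, j)) = M $$ (i, j)"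
  shows "mat_kernel (M ^\<^sub>m Suc k) = mat_kernel M"
proof -
  have square: "M *\<^sub>v v = 0\<^sub>v n" if v: "v \<in> carrier_vec n" and 0: "M *\<^sub>v (M *\<^sub>v v) = 0\<^sub>v n" for v
  proof -
    let ?w = "M *\<^sub>v v"
    have w: "?w \<in> carrier_vec n" using M v by auto
    have cw: "conjugate ?w = M *\<^sub>v conjugate v"
      using M v real by (intro eq_vecI) (auto simp: scalar_prod_def)
    have "?w \<bullet>c ?w = (M\<^sup>T *\<^sub>v ?w) \<bullet> conjugate v"
      unfolding cw using M v w by (intro transpose_vec_mult_scalar[symmetric]) auto
    also have "\<dots> = 0" using 0 v by (simp add: sym)
    finally show ?thesis using conjugate_square_eq_0_vec[OF w] by simp
  qed
  have "M *\<^sub>v v = 0\<^sub>v n" if "v \<in> carrier_vec n" "(M ^\<^sub>m Suc k) *\<^sub>v v = 0\<^sub>v n" for v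
    using that
  proof (induction k arbitrary: v)
    case 0
    then show ?case using M by simp
  next
    case (Suc k)
    have "(M ^\<^sub>m Suc (Suc k)) *\<^sub>v v = (M ^\<^sub>m Suc k) *\<^sub>v (M *\<^sub>v v)"
      using assoc_mult_mat_vec[OF pow_carrier_mat[OF M, of "Suc k"] M Suc.prems(1)] by simp
    with Suc have "M *\<^sub>v (M *\<^sub>v v) = 0\<^sub>v n"
      using M by (intro Suc.IH) auto
    with square Suc.prems show ?case by auto
  qed
  moreover have "(M ^\<^sub>m Suc k) *\<^sub>v v = 0\<^sub>v n" if "v \<in> carrier_vec n" "M *\<^sub>v v = 0\<^sub>v n" for v
    using that assoc_mult_mat_vec[OF pow_carrier_mat[OF M, of k] M that(1)] pow_carrier_mat[OF M, of k]
    by (auto intro!: eq_vecI simp: scalar_prod_def)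
  ultimately show ?thesis
    using M by (auto simp: mat_kernel_def)
qed

text \<open>All Jordan blocks of a real symmetric matrix have size 1, as its powers have the same kernel.\<close>

lemma kernel_dim_char_matrix_symmetric_real:
  fixes A :: "real mat" and e :: real
  assumes A: "A \<in> carrier_mat n n" and sym: "A\<^sup>T = A"
  defines "C \<equiv> map_mat complex_of_real A"
  shows "kernel_dim (char_matrix C (complex_of_real e)) = Polynomial.order (complex_of_real e) (char_poly C)"
proof -
  let ?e = "complex_of_real e"
  have C: "C \<in> carrier_mat n n" using A by (auto simp: C_def)
  let ?M = "char_matrix C ?e"
  have M: "?M \<in> carrier_mat n n" using C by simp
  have symA: "A $$ (i, j) = A $$ (j, i)" if "i < n" "j < n" for i j
    using that A sym by (metis carrier_matD index_transpose_mat(1))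
  have symM: "?M\<^sup>T = ?M"
    using A symA by (intro eq_matI) (auto simp: C_def char_matrix_def)
  have realM: "cnj (?M $$ (i, j)) = ?M $$ (i, j)" if "i < n" "j < n" for i j
    using A that by (auto simp: C_def char_matrix_def)
  obtain n_as where jnf: "jordan_nf C n_as"
    using char_poly_factorized[OF C] jordan_nf_exists[OF C] by blast
  let ?ns = "map fst [(n, a)\<leftarrow>n_as . a = ?e]"
  let ?k = "Polynomial.order ?e (char_poly C)"
  have ns: "?k = sum_list ?ns"
    unfolding jordan_nf_order[OF jnf] by (simp add: case_prod_beta')
  \<comment> \<open>The exponent is a successor, as the kernel lemma requires, and exceeds every
    block size, since these sizes add up to \<open>?k\<close>. Hence the minima below are the block
    sizes themselves.\<close>
  have "kernel_dim ?M = kernel_dim (?M ^\<^sub>m Suc ?k)"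
    using mat_kernel_pow_symmetric_real[OF M symM realM, of ?k] M
    by (simp add: kernel_dim_def del: pow_mat.simps)
  also have "\<dots> = (\<Sum>n\<leftarrow>?ns. min (Suc ?k) n)"
    using dim_gen_eigenspace[OF jnf, of ?e "Suc ?k"] unfolding dim_gen_eigenspace_def .
  also have "\<dots> = (\<Sum>n\<leftarrow>?ns. n)"
  proof -
    have "map (min (Suc ?k)) ?ns = map (\<lambda>n. n) ?ns"
      using member_le_sum_list[of _ ?ns] unfolding ns by (intro map_cong refl) (fastforce intro: min_absorb2 le_SucI)
    then show ?thesis by (rule arg_cong)
  qed
  finally show ?thesis using ns by simp
qed

text \<open>The complex kernel of \<open>A - e I\<close> has dimension at least
  \<open>n - r\<close>, more than the number of coordinates outside \<open>J\<close>. So some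
  nonzero kernel vector vanishes outside \<open>J\<close>, and its entries yield the coefficients of
  the relation.\<close>

lemma symmetric_columns_dependent:
  fixes A :: "real mat" and e :: real
  assumes A: "A \<in> carrier_mat n n" and sym: "A\<^sup>T = A"
    and mult: "[:-e, 1:] ^ (n - r) dvd char_poly A"
    and J: "J \<subseteq> {..<n}" "card J > r"
  shows "\<exists>c. (\<exists>j\<in>J. c j \<noteq> 0) \<and>
    (\<forall>u<n. (\<Sum>j\<in>J. (A $$ (u, j) - (if u = j then e else 0)) * c j) = 0)"
proof -
  let ?C = "map_mat complex_of_real A"
  let ?e = "complex_of_real e"
  let ?M = "char_matrix ?C ?e"
  have C: "?C \<in> carrier_mat n n" and M: "?M \<in> carrier_mat n n" using A by auto
  have Mij: "?M $$ (i, j) = complex_of_real (A $$ (i, j) - (if i = j then e else 0))" if "i < n" "j < n" for i j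
    using that A by (auto simp: char_matrix_def)
  interpret map_poly_comm_ring_hom complex_of_real ..
  from mult obtain q where "char_poly A = [:-e, 1:] ^ (n - r) * q" by (auto elim: dvdE)
  then have "char_poly ?C = [:-?e, 1:] ^ (n - r) * map_poly complex_of_real q"
    by (simp add: of_real_hom.char_poly_hom[OF A] hom_distribs)
  then have "[:-?e, 1:] ^ (n - r) dvd char_poly ?C" by simp
  moreover have "char_poly ?C \<noteq> 0" using degree_monic_char_poly[OF C] by auto
  ultimately have "n - r \<le> Polynomial.order ?e (char_poly ?C)" by (rule order_max)
  then have dim: "n - r \<le> kernel_dim ?M"
    using kernel_dim_char_matrix_symmetric_real[OF A sym] by simp
  interpret K: kernel n n ?M by unfold_locales (rule M)
  obtain B where B: "finite B" "K.basis B"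
    using kernel_basis_exists[OF M] by blast
  then have BK: "B \<subseteq> mat_kernel ?M" and indep: "\<not> K.lin_dep B" and cardB: "card B = kernel_dim ?M"
    using K.Ker.dim_basis[OF B] by (auto simp: K.Ker.basis_def)
  have Bc: "v \<in> carrier_vec n" "?M *\<^sub>v v = 0\<^sub>v n" if "v \<in> B" for v
    using BK mat_kernelD[OF M] that by auto
  have "card ({..<n} - J) < card B"
    using J dim cardB card_mono[of "{..<n}" J]
    by (subst card_Diff_subset) (auto intro: finite_subset)
  \<comment> \<open>One unknown for each basis vector, one equation for each coordinate outside
    \<open>J\<close> that has to vanish; \<open>w\<close> is the resulting kernel vector.\<close>
  from homogeneous_system_nontrivial_solution[OF _ \<open>finite B\<close> this, of "\<lambda>k v. v $ k"]
  obtain x where x: "\<exists>v\<in>B. x v \<noteq> 0" "\<forall>k\<in>{..<n} - J. (\<Sum>v\<in>B. v $ k * x v) = 0"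
    by auto
  define w where "w k = (\<Sum>v\<in>B. v $ k * x v)" for k
  have wker: "(\<Sum>k<n. ?M $$ (u, k) * w k) = 0" if "u < n" for u
  proof -
    have "(\<Sum>k<n. ?M $$ (u, k) * v $ k) = 0" if "v \<in> B" for v
      using arg_cong[OF Bc(2)[OF that], of "\<lambda>v. v $ u"] Bc(1)[OF that] M \<open>u < n\<close>
      by (simp add: scalar_prod_def lessThan_atLeast0)
    then have "(\<Sum>v\<in>B. x v * (\<Sum>k<n. ?M $$ (u, k) * v $ k)) = 0" by simp
    also have "(\<Sum>v\<in>B. x v * (\<Sum>k<n. ?M $$ (u, k) * v $ k)) = (\<Sum>k<n. ?M $$ (u, k) * w k)"
      unfolding w_def sum_distrib_left by (subst sum.swap) (simp add: mult_ac)
    finally show ?thesis .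
  qed
  have "\<exists>k<n. w k \<noteq> 0"
  proof (rule ccontr)
    assume "\<not> (\<exists>k<n. w k \<noteq> 0)"
    moreover have lincomb_carrier: "K.lincomb x B \<in> carrier_vec n"
      using K.lincomb_same[OF BK, of x] K.NC.lincomb_closed[of B x] Bc(1) by auto
    ultimately have "K.lincomb x B = 0\<^sub>v n"
      using BK K.lincomb_index[OF _ BK, of _ x] lincomb_carrier
      by (intro eq_vecI) (auto simp: w_def mult.commute)
    with x(1) B indep show False
      by (auto simp: K.Ker.lin_dep_def)
  qed
  then obtain k where k: "k < n" "w k \<noteq> 0" by auto
  then have "k \<in> J" using x(2) by (auto simp: w_def)
  define a where "a u j = A $$ (u, j) - (if u = j then e else 0)" for u j
  have sum0: "(\<Sum>j\<in>J. complex_of_real (a u j) * w j) = 0" if "u < n" for u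
  proof -
    have "(\<Sum>j\<in>J. complex_of_real (a u j) * w j) = (\<Sum>j\<in>J. ?M $$ (u, j) * w j)"
      using J that by (intro sum.cong) (auto simp: a_def Mij subset_iff simp del: of_real_diff)
    also have "\<dots> = (\<Sum>k<n. ?M $$ (u, k) * w k)"
      using J x(2) by (intro sum.mono_neutral_left) (auto simp: w_def)
    finally show ?thesis using wker that by simp
  qed
  \<comment> \<open>The coefficients \<open>a\<close> are real, so both parts of \<open>w\<close>
    satisfy the relation, and one of them is nonzero at \<open>k\<close>.\<close>
  have Re: "\<forall>u<n. (\<Sum>j\<in>J. a u j * Re (w j)) = 0"
    and Im: "\<forall>u<n. (\<Sum>j\<in>J. a u j * Im (w j)) = 0"
    using arg_cong[OF sum0, of _ Re] arg_cong[OF sum0, of _ Im] by simp_all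
  consider "Re (w k) \<noteq> 0" | "Im (w k) \<noteq> 0" using k by (auto simp: complex_eq_iff)
  then show ?thesis
  proof cases
    case 1
    with Re \<open>k \<in> J\<close> show ?thesis
      unfolding a_def by (intro exI[of _ "\<lambda>j. Re (w j)"] conjI bexI[of _ k])
  next
    case 2
    with Im \<open>k \<in> J\<close> show ?thesis
      unfolding a_def by (intro exI[of _ "\<lambda>j. Im (w j)"] conjI bexI[of _ k])
  qed
qed

section \<open>Determinants of order up to four\<close>

lemma det_2x2:
  assumes "A \<in> carrier_mat 2 2"
  shows "det A = A $$ (0, 0) * A $$ (1, 1) - A $$ (0, 1) * A $$ (1, 0)"
  using assms
  by (simp add: laplace_expansion_row[of _ 2 0] cofactor_def det_single mat_delete_def numeral_2_eq_2)

lemma det_3x3: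
  assumes "A \<in> carrier_mat 3 3"
  shows "det A = A $$ (0, 0) * (A $$ (1, 1) * A $$ (2, 2) - A $$ (1, 2) * A $$ (2, 1))
    - A $$ (0, 1) * (A $$ (1, 0) * A $$ (2, 2) - A $$ (1, 2) * A $$ (2, 0))
    + A $$ (0, 2) * (A $$ (1, 0) * A $$ (2, 1) - A $$ (1, 1) * A $$ (2, 0))"
proof -
  have "{..<3} = {0, 1, 2 :: nat}" by auto
  then show ?thesis
  using assms
  by (simp add: laplace_expansion_row[of _ 3 0] cofactor_def det_2x2 mat_delete_def flip: numeral_2_eq_2)
       (simp add: algebra_simps)
qed

lemma det_4x4:
  assumes "A \<in> carrier_mat 4 4"
  shows "det A =
      A $$ (0, 0) * (A $$ (1, 1) * (A $$ (2, 2) * A $$ (3, 3) - A $$ (2, 3) * A $$ (3, 2))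
        - A $$ (1, 2) * (A $$ (2, 1) * A $$ (3, 3) - A $$ (2, 3) * A $$ (3, 1))
        + A $$ (1, 3) * (A $$ (2, 1) * A $$ (3, 2) - A $$ (2, 2) * A $$ (3, 1)))
    - A $$ (0, 1) * (A $$ (1, 0) * (A $$ (2, 2) * A $$ (3, 3) - A $$ (2, 3) * A $$ (3, 2))
        - A $$ (1, 2) * (A $$ (2, 0) * A $$ (3, 3) - A $$ (2, 3) * A $$ (3, 0))
        + A $$ (1, 3) * (A $$ (2, 0) * A $$ (3, 2) - A $$ (2, 2) * A $$ (3, 0)))
    + A $$ (0, 2) * (A $$ (1, 0) * (A $$ (2, 1) * A $$ (3, 3) - A $$ (2, 3) * A $$ (3, 1))
        - A $$ (1, 1) * (A $$ (2, 0) * A $$ (3, 3) - A $$ (2, 3) * A $$ (3, 0))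
        + A $$ (1, 3) * (A $$ (2, 0) * A $$ (3, 1) - A $$ (2, 1) * A $$ (3, 0)))
    - A $$ (0, 3) * (A $$ (1, 0) * (A $$ (2, 1) * A $$ (3, 2) - A $$ (2, 2) * A $$ (3, 1))
        - A $$ (1, 1) * (A $$ (2, 0) * A $$ (3, 2) - A $$ (2, 2) * A $$ (3, 0))
        + A $$ (1, 2) * (A $$ (2, 0) * A $$ (3, 1) - A $$ (2, 1) * A $$ (3, 0)))"
proof -
  have "{..<4} = {0, 1, 2, 3 :: nat}" by auto
  then show ?thesis
  using assms
  by (simp add: laplace_expansion_row[of _ 4 0] cofactor_def det_3x3 mat_delete_def flip: numeral_2_eq_2 numeral_3_eq_3)
       (simp add: algebra_simps)
qed

section \<open>Characteristic polynomials of blow-ups\<close>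

lemma poly_char_poly_det:
  fixes A :: "'a :: field mat"
  assumes A: "A \<in> carrier_mat n n"
  shows "poly (char_poly A) x = det (x \<cdot>\<^sub>m 1\<^sub>m n - A)"
proof -
  have "- char_matrix A x = x \<cdot>\<^sub>m 1\<^sub>m n - A"
    using A by (intro eq_matI) (auto simp: char_matrix_def)
  then show ?thesis using char_poly_matrix[OF A] by simp
qed

definition class_size :: "nat \<Rightarrow> (nat \<Rightarrow> nat) \<Rightarrow> nat \<Rightarrow> nat" where
  "class_size n \<phi> i = card {u. u < n \<and> \<phi> u = i}"

text \<open>When \<open>S\<close> lists the entries of \<open>D + I\<close> between classes, entry
  \<open>(i, j)\<close> is the sum of a row of class \<open>i\<close> over the columns of class
  \<open>j\<close>: the quotient by an equitable partition.\<close>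

definition quotient_mat :: "nat \<Rightarrow> (nat \<Rightarrow> nat \<Rightarrow> real) \<Rightarrow> nat \<Rightarrow> (nat \<Rightarrow> nat) \<Rightarrow> real mat" where
  "quotient_mat k S n \<phi> = mat k k (\<lambda>(i, j). S i j * real (class_size n \<phi> j))"

text \<open>\<open>A + I\<close> factors as \<open>P * C\<close> with \<open>P\<close> the incidence
  matrix of vertices and classes, while \<open>C * P\<close> is the quotient. The determinant
  identity at \<open>x + 1\<close> then compares the two, which explains the shift by
  \<open>[:1, 1:]\<close>.\<close>

lemma char_poly_blowup:
  fixes A :: "real mat"
  assumes A: "A \<in> carrier_mat n n" and \<phi>: "\<And>u. u < n \<Longrightarrow> \<phi> u < k"
    and blowup: "\<And>u v. u < n \<Longrightarrow> v < n \<Longrightarrow> A $$ (u, v) + (if u = v then 1 else 0) = S (\<phi> u) (\<phi> v)"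
  shows "[:1, 1:] ^ k * char_poly A = [:1, 1:] ^ n * pcompose (char_poly (quotient_mat k S n \<phi>)) [:1, 1:]"
proof -
  let ?Q = "quotient_mat k S n \<phi>"
  have Q: "?Q \<in> carrier_mat k k" by (simp add: quotient_mat_def)
  define P where "P = mat n k (\<lambda>(u, i). if \<phi> u = i then 1 else 0 :: real)"
  define C where "C = mat k n (\<lambda>(i, v). S i (\<phi> v))"
  have P: "P \<in> carrier_mat n k" and C: "C \<in> carrier_mat k n" by (auto simp: P_def C_def)
  have "C * P = ?Q"
  proof (rule eq_matI)
    fix i j assume "i < dim_row ?Q" "j < dim_col ?Q"
    then have ij: "i < k" "j < k" by (auto simp: quotient_mat_def)
    then have "(C * P) $$ (i, j) = (\<Sum>v = 0..<n. if \<phi> v = j then S i (\<phi> v) else 0)"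
      by (auto simp: C_def P_def scalar_prod_def intro!: sum.cong)
    also have "\<dots> = (\<Sum>v | v < n \<and> \<phi> v = j. S i j)"
      by (rule sum.mono_neutral_cong_right) auto
    finally show "(C * P) $$ (i, j) = ?Q $$ (i, j)"
      using ij by (simp add: quotient_mat_def class_size_def)
  qed (simp_all add: C_def P_def quotient_mat_def)
  moreover have PC: "(x + 1) \<cdot>\<^sub>m 1\<^sub>m n - P * C = x \<cdot>\<^sub>m 1\<^sub>m n - A" for x
  proof (rule eq_matI)
    fix u v assume "u < dim_row (x \<cdot>\<^sub>m 1\<^sub>m n - A)" "v < dim_col (x \<cdot>\<^sub>m 1\<^sub>m n - A)"
    then have uv: "u < n" "v < n" using A by auto
    then have "(P * C) $$ (u, v) = (\<Sum>i = 0..<k. (if \<phi> u = i then 1 else 0) * S i (\<phi> v))"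
      by (simp add: C_def P_def scalar_prod_def)
    also have "\<dots> = (\<Sum>i\<in>{\<phi> u}. S i (\<phi> v))"
      by (rule sum.mono_neutral_cong_right) (use \<phi>[OF uv(1)] in auto)
    also have "\<dots> = S (\<phi> u) (\<phi> v)" by simp
    finally have "(P * C) $$ (u, v) = A $$ (u, v) + (if u = v then 1 else 0)"
      using blowup uv by simp
    then show "((x + 1) \<cdot>\<^sub>m 1\<^sub>m n - P * C) $$ (u, v) = (x \<cdot>\<^sub>m 1\<^sub>m n - A) $$ (u, v)"
      using uv A P C by simp
  qed (use A P C in auto)
  ultimately have "(x + 1) ^ k * poly (char_poly A) x = (x + 1) ^ n * poly (char_poly ?Q) (x + 1)" for x
    using det_smult_one_minus_mult_commute[OF P C, of "x + 1"] PC
    by (simp add: poly_char_poly_det[OF A] poly_char_poly_det[OF Q])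
  then show ?thesis
    by (intro poly_eq_poly_eq_iff[THEN iffD1] ext) (simp add: poly_pcompose add.commute)
qed

text \<open>The factor \<open>[:1, 1:] ^ n\<close> cancels in \<open>char_poly_blowup\<close> and
  the shift by 1 is invertible, so cospectral blow-ups can be compared through their
  quotients.\<close>

lemma char_poly_quotient_mat_eq:
  fixes A B :: "real mat"
  assumes "A \<in> carrier_mat n n" "\<And>u. u < n \<Longrightarrow> \<phi> u < k"
    and "\<And>u v. u < n \<Longrightarrow> v < n \<Longrightarrow> A $$ (u, v) + (if u = v then 1 else 0) = S (\<phi> u) (\<phi> v)"
    and "B \<in> carrier_mat n n" "\<And>u. u < n \<Longrightarrow> \<psi> u < k"
    and "\<And>u v. u < n \<Longrightarrow> v < n \<Longrightarrow> B $$ (u, v) + (if u = v then 1 else 0) = T (\<psi> u) (\<psi> v)"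
    and "char_poly A = char_poly B"
  shows "char_poly (quotient_mat k S n \<phi>) = char_poly (quotient_mat k T n \<psi>)"
proof -
  let ?Q = "quotient_mat k S n \<phi>" and ?R = "quotient_mat k T n \<psi>"
  have "[:1, 1:] ^ n * pcompose (char_poly ?Q) [:1, 1:] = [:1, 1:] ^ k * char_poly A"
    using assms(1-3) by (rule char_poly_blowup[symmetric])
  also have "\<dots> = [:1, 1:] ^ n * pcompose (char_poly ?R) [:1, 1:]"
    unfolding assms(7) using assms(4-6) by (rule char_poly_blowup)
  finally have eq: "pcompose (char_poly ?Q) [:1, 1:] = pcompose (char_poly ?R) [:1, 1:]" by simp
  have "poly (char_poly ?Q) x = poly (char_poly ?R) x" for x
    using arg_cong[OF eq, of "\<lambda>p. poly p (x - 1)"] by (simp add: poly_pcompose)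
  then show ?thesis by (intro poly_eq_poly_eq_iff[THEN iffD1] ext) 
qed

text \<open>Over the complex numbers a monic polynomial is the product of the linear factors given
  by its root multiset; its degree is the number of vertices.\<close>

lemma D_spectrum_eq_imp_char_poly_eq:
  assumes "D_spectrum m F = D_spectrum n E"
  shows "char_poly (distance_matrix m F) = char_poly (distance_matrix n E)" and "m = n"
proof -
  let ?p = "\<lambda>m F. map_poly complex_of_real (char_poly (distance_matrix m F))"
  have carrier: "distance_matrix m F \<in> carrier_mat m m" for m F
    by (simp add: distance_matrix_def)
  have monic: "lead_coeff (?p m F) = 1" for m F
    using degree_monic_char_poly[OF carrier, of m F] by (simp add: degree_map_poly coeff_map_poly)
  have "?p m F = (\<Prod>x\<in>#D_spectrum m F. [:-x, 1:])" for m F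
    using complex_poly_decompose_multiset[of "?p m F"] by (simp only: D_spectrum_def monic smult_1_left)
  with assms have eq: "?p m F = ?p n E" by metis
  show *: "char_poly (distance_matrix m F) = char_poly (distance_matrix n E)"
  proof (rule poly_eqI)
    fix i show "coeff (char_poly (distance_matrix m F)) i = coeff (char_poly (distance_matrix n E)) i"
      using arg_cong[OF eq, of "\<lambda>p. coeff p i"] by (simp add: coeff_map_poly)
  qed
  show "m = n"
    using degree_monic_char_poly[OF carrier, of m F] degree_monic_char_poly[OF carrier, of n E] * by simp
qed

section \<open>Distances in connected graphs\<close>

locale conn_graph =
  fixes n :: nat and E :: "nat \<Rightarrow> nat \<Rightarrow> bool"
  assumes simple: "simple_graph n E" and connected: "connected_graph n E"
begin

abbreviation d :: "nat \<Rightarrow> nat \<Rightarrow> nat" where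
  "d \<equiv> gdist E"

lemma edgeD: "E i j \<Longrightarrow> i < n \<and> j < n \<and> i \<noteq> j \<and> E j i"
  using simple by (auto simp: simple_graph_def)

lemma relpowp_d: "i < n \<Longrightarrow> j < n \<Longrightarrow> (E ^^ d i j) i j"
  using connected unfolding connected_graph_def gdist_def by (metis LeastI_ex)

lemma d_le: "(E ^^ k) i j \<Longrightarrow> d i j \<le> k"
  unfolding gdist_def by (rule Least_le)

lemma relpowp_sym: "(E ^^ k) i j \<Longrightarrow> (E ^^ k) j i"
proof (induction k arbitrary: j)
  case (Suc k)
  then obtain z where "(E ^^ k) i z" "E z j" by auto
  with Suc.IH show ?case using edgeD by (metis relpowp_Suc_I2)
qed auto

lemma d_sym: "i < n \<Longrightarrow> j < n \<Longrightarrow> d i j = d j i"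
  using relpowp_d d_le relpowp_sym by (meson le_antisym)

lemma d_refl [simp]: "d i i = 0"
  using d_le[of 0 i i] by simp

lemma d_eq_0_iff: "i < n \<Longrightarrow> j < n \<Longrightarrow> d i j = 0 \<longleftrightarrow> i = j"
  using relpowp_d[of i j] by auto

lemma d_triangle: "i < n \<Longrightarrow> j < n \<Longrightarrow> k < n \<Longrightarrow> d i k \<le> d i j + d j k"
  using relpowp_d d_le relpowp_trans by metis

lemma d_eq_1_iff: "i < n \<Longrightarrow> j < n \<Longrightarrow> d i j = 1 \<longleftrightarrow> E i j"
proof
  assume "i < n" "j < n" "d i j = 1"
  then show "E i j" using relpowp_d[of i j] by (simp add: eq_OO)
next
  assume "E i j"
  then have "d i j \<le> 1" "d i j \<noteq> 0" using d_le[of 1 i j] d_eq_0_iff edgeD by auto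
  then show "d i j = 1" by simp
qed

lemma d_Suc_ex: 
  assumes "i < n" "j < n" "d i j = Suc k"
  shows "\<exists>z<n. E i z \<and> d z j = k"
proof -
  have "(E ^^ Suc k) i j" using relpowp_d[OF assms(1,2)] assms(3) by simp
  then obtain z where z: "E i z" "(E ^^ k) z j" by (meson relpowp_Suc_D2)
  have "z < n" using edgeD[OF z(1)] by simp
  moreover have "d z j = k"
    using d_le[OF z(2)] d_triangle[OF assms(1) \<open>z < n\<close> assms(2)] d_le[of 1 i z] z(1) assms(3) by (simp add: eq_OO)
  ultimately show ?thesis using z by auto
qed

lemma d_eq_2_ex:
  assumes "i < n" "j < n" "d i j = 2"
  shows "\<exists>z<n. E i z \<and> E z j"
  using d_Suc_ex[of i j 1] d_eq_1_iff assms by (auto simp: numeral_2_eq_2)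

text \<open>These are the last four vertices of a shortest path from \<open>x\<close> to
  \<open>y\<close>: the induction advances \<open>x\<close> along the path until distance 3 remains,
  so only the end \<open>y\<close> is kept.\<close>

lemma isometric_path:
  assumes "x < n" "y < n" "d x y \<ge> 3"
  obtains p q r where "p < n" "q < n" "r < n" "d p q = 1" "d q r = 1" "d r y = 1"
    "d p r = 2" "d q y = 2" "d p y = 3"
proof -
  have "\<exists>p<n. d p y = 3"
    using assms(1,3)
  proof (induction "d x y" arbitrary: x rule: less_induct)
    case less
    show ?case
    proof (cases "d x y = 3")
      case False
      with less.prems obtain k where k: "d x y = Suc k" "3 \<le> k" by (cases "d x y") auto
      with d_Suc_ex[OF less.prems(1) assms(2)] obtain z where "z < n" "d z y = k" by auto
      with less.hyps[of z] k show ?thesis by simp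
    qed (use less in auto)
  qed
  then obtain p where p: "p < n" "d p y = 3" by auto
  then obtain q where q: "q < n" "E p q" "d q y = 2"
    using d_Suc_ex[OF _ assms(2), of p 2] by auto
  then obtain r where r: "r < n" "E q r" "d r y = 1"
    using d_Suc_ex[OF _ assms(2), of q 1] by auto
  have pq: "d p q = 1" and qr: "d q r = 1" using q r p d_eq_1_iff by auto
  have "d p r = 2"
    using d_triangle[OF p(1) q(1) r(1)] d_triangle[OF p(1) r(1) assms(2)] p q r pq qr by simp
  with that[OF p(1) q(1) r(1) pq qr r(3) _ q(3) p(2)] show thesis by simp
qed

text \<open>The entries of \<open>D + I\<close>; with this diagonal, adjacent twins have equal rows.\<close>

definition dist1 :: "nat \<Rightarrow> nat \<Rightarrow> nat" where
  "dist1 u v = (if u = v then 1 else d u v)"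

lemma dist1_refl [simp]: "dist1 u u = 1"
  by (simp add: dist1_def)

lemma dist1_sym: "u < n \<Longrightarrow> v < n \<Longrightarrow> dist1 u v = dist1 v u"
  using d_sym by (simp add: dist1_def)

lemma dist1_pos: "u < n \<Longrightarrow> v < n \<Longrightarrow> dist1 u v \<ge> 1"
  using d_eq_0_iff[of u v] by (auto simp: dist1_def)

lemma dist1_eq_1_iff: "u < n \<Longrightarrow> v < n \<Longrightarrow> dist1 u v = 1 \<longleftrightarrow> u = v \<or> E u v"
  using d_eq_1_iff[of u v] by (auto simp: dist1_def)

lemma E_iff_dist1: "u < n \<Longrightarrow> v < n \<Longrightarrow> E u v \<longleftrightarrow> u \<noteq> v \<and> dist1 u v = 1"
  using dist1_eq_1_iff edgeD by blast

lemma distance_matrix_dist1: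
  "u < n \<Longrightarrow> v < n \<Longrightarrow> distance_matrix n E $$ (u, v) + (if u = v then 1 else 0) = real (dist1 u v)"
  by (simp add: distance_matrix_def dist1_def)

text \<open>Raising the diagonal from 0 to 1 does no harm: at \<open>z = u\<close> the left side is
  1, and at \<open>z = v\<close> it is the length of an edge.\<close>

lemma dist1_edge_lipschitz:
  assumes "E u v" "z < n" 
  shows "dist1 z u \<le> dist1 z v + 1"
proof -
  have uv: "u < n" "v < n" "d v u = 1" using edgeD[OF assms(1)] d_eq_1_iff by auto
  show ?thesis
    using d_triangle[OF assms(2) uv(2,1)] dist1_pos[OF assms(2) uv(2)] uv by (auto simp: dist1_def split: if_splits)
qed

end

text \<open>Since \<open>D\<close> is symmetric, this multiplicity of the eigenvalue
  \<open>-1\<close> bounds the rank of \<open>D + I\<close> by 4. It is all that the structural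
  classification takes from cospectrality.\<close>

locale rank4_graph = conn_graph +
  assumes mult: "[:1, 1:] ^ (n - 4) dvd char_poly (distance_matrix n E)"
begin

text \<open>The five columns are dependent, and \<open>nonsing\<close> forbids a relation among the
  four columns alone, so column \<open>z\<close> can be solved for. Nonsingularity is phrased as a
  homogeneous system that the simplifier can solve for concrete distances.\<close>

lemma column_combination:
  assumes a: "a0 < n" "a1 < n" "a2 < n" "a3 < n" and z: "z < n"
    and distinct: "distinct [a0, a1, a2, a3]"
    and nonsing: "\<And>(c0 :: real) (c1 :: real) (c2 :: real) (c3 :: real).
      \<lbrakk>dist1 a0 a0 * c0 + dist1 a0 a1 * c1 + dist1 a0 a2 * c2 + dist1 a0 a3 * c3 = 0;
        dist1 a1 a0 * c0 + dist1 a1 a1 * c1 + dist1 a1 a2 * c2 + dist1 a1 a3 * c3 = 0;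
        dist1 a2 a0 * c0 + dist1 a2 a1 * c1 + dist1 a2 a2 * c2 + dist1 a2 a3 * c3 = 0;
        dist1 a3 a0 * c0 + dist1 a3 a1 * c1 + dist1 a3 a2 * c2 + dist1 a3 a3 * c3 = 0\<rbrakk>
      \<Longrightarrow> c0 = 0 \<and> c1 = 0 \<and> c2 = 0 \<and> c3 = 0"
  shows "\<exists>(x0 :: real) (x1 :: real) (x2 :: real) (x3 :: real).
    \<forall>u<n. dist1 u z = dist1 u a0 * x0 + dist1 u a1 * x1 + dist1 u a2 * x2 + dist1 u a3 * x3"
proof (cases "z \<in> {a0, a1, a2, a3}")
  case True
  \<comment> \<open>Here \<open>?J\<close> would have only four elements; a unit vector of
    coefficients serves instead.\<close>
  then consider "z = a0" | "z = a1" | "z = a2" | "z = a3" by auto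
  then show ?thesis
  proof cases
    case 1 show ?thesis by (rule exI[of _ 1], rule exI[of _ 0], rule exI[of _ 0], rule exI[of _ 0]) (simp add: 1)
  next
    case 2 show ?thesis by (rule exI[of _ 0], rule exI[of _ 1], rule exI[of _ 0], rule exI[of _ 0]) (simp add: 2)
  next
    case 3 show ?thesis by (rule exI[of _ 0], rule exI[of _ 0], rule exI[of _ 1], rule exI[of _ 0]) (simp add: 3)
  next
    case 4 show ?thesis by (rule exI[of _ 0], rule exI[of _ 0], rule exI[of _ 0], rule exI[of _ 1]) (simp add: 4)
  qed
next
  case False
  let ?J = "{z, a0, a1, a2, a3}"
  let ?A = "distance_matrix n E"
  have A: "?A \<in> carrier_mat n n" by (simp add: distance_matrix_def)
  have sym: "?A\<^sup>T = ?A" using d_sym by (intro eq_matI) (auto simp: distance_matrix_def)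
  have "card ?J > 4" using distinct False by auto
  with symmetric_columns_dependent[OF A sym, of "-1" 4 ?J] mult a z
  obtain c where nz: "\<exists>j\<in>?J. c j \<noteq> 0"
    and c: "\<And>u. u < n \<Longrightarrow> (\<Sum>j\<in>?J. (?A $$ (u, j) - (if u = j then -1 else 0)) * c j) = 0"
    by auto
  have eq: "dist1 u z * c z + dist1 u a0 * c a0 + dist1 u a1 * c a1 + dist1 u a2 * c a2 + dist1 u a3 * c a3 = 0"
    if "u < n" for u
  proof -
    \<comment> \<open>Subtracting the eigenvalue \<open>-1\<close> on the diagonal turns
      \<open>D\<close> into \<open>D + I\<close>.\<close>
    have "(\<Sum>j\<in>?J. (?A $$ (u, j) - (if u = j then -1 else 0)) * c j) = (\<Sum>j\<in>?J. dist1 u j * c j)"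
      using that a z by (intro sum.cong refl) (auto simp: distance_matrix_def dist1_def)
    then show ?thesis using c[OF that] distinct False by auto
  qed
  have cz: "c z \<noteq> 0"
  proof
    assume 0: "c z = 0"
    have "c a0 = 0 \<and> c a1 = 0 \<and> c a2 = 0 \<and> c a3 = 0"
      by (rule nonsing) (use eq[OF a(1)] eq[OF a(2)] eq[OF a(3)] eq[OF a(4)] 0 in simp_all)
    with 0 nz show False by auto
  qed
  have "real (dist1 u z) = dist1 u a0 * (- c a0 / c z) + dist1 u a1 * (- c a1 / c z)
      + dist1 u a2 * (- c a2 / c z) + dist1 u a3 * (- c a3 / c z)" if "u < n" for u
  proof -
    have "dist1 u z * c z = - (dist1 u a0 * c a0 + dist1 u a1 * c a1 + dist1 u a2 * c a2 + dist1 u a3 * c a3)"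
      using eq[OF that] by linarith
    then have "real (dist1 u z) = - (dist1 u a0 * c a0 + dist1 u a1 * c a1 + dist1 u a2 * c a2 + dist1 u a3 * c a3) / c z"
      using cz by (simp add: eq_divide_eq)
    then show ?thesis by (simp add: add_divide_distrib diff_divide_distrib)
  qed
  then show ?thesis by blast
qed

end

section \<open>Twins of four vertices\<close>

text \<open>The matrices \<open>D + I\<close> with the vertices numbered along the path, from the
  centre of the claw, and around the cycle. The diagonal entry 1 makes each class of a blow-up a
  clique.\<close>

definition "P4_rows = [[1, 1, 2, 3], [1, 1, 1, 2], [2, 1, 1, 1], [3, 2, 1, 1 :: nat]]"
definition "K13_rows = [[1, 1, 1, 1], [1, 1, 2, 2], [1, 2, 1, 2], [1, 2, 2, 1 :: nat]]"
definition "C4_rows = [[1, 1, 2, 1], [1, 1, 1, 2], [2, 1, 1, 1], [1, 2, 1, 1 :: nat]]"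

definition entry :: "nat list list \<Rightarrow> nat \<Rightarrow> nat \<Rightarrow> nat" where
  "entry R i j = R ! i ! j"

lemma less_4_cases: "i < (4 :: nat) \<longleftrightarrow> i = 0 \<or> i = 1 \<or> i = 2 \<or> i = 3"
  by auto

context conn_graph
begin

text \<open>Equal columns replace one vertex by its representative; symmetry of \<open>dist1\<close>
  then allows the same for the other.\<close>

lemma blowup_of_rows:
  assumes a: "a0 < n" "a1 < n" "a2 < n" "a3 < n"
    and rows: "\<And>z. z < n \<Longrightarrow> \<exists>w\<in>{a0, a1, a2, a3}. \<forall>u<n. dist1 u z = dist1 u w"
    and R: "\<And>i j. i < 4 \<Longrightarrow> j < 4 \<Longrightarrow> dist1 ([a0, a1, a2, a3] ! i) ([a0, a1, a2, a3] ! j) = entry R i j"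
  obtains \<phi> where "\<And>u. u < n \<Longrightarrow> \<phi> u < 4"
    "\<And>u v. u < n \<Longrightarrow> v < n \<Longrightarrow> dist1 u v = entry R (\<phi> u) (\<phi> v)"
proof -
  let ?a = "\<lambda>i. [a0, a1, a2, a3] ! i"
  have an: "?a i < n" if "i < 4" for i using that a by (auto simp: less_4_cases)
  have "\<forall>z. z < n \<longrightarrow> (\<exists>i<4. \<forall>u<n. dist1 u z = dist1 u (?a i))"
  proof (intro allI impI)
    fix z assume "z < n"
    from rows[OF this] show "\<exists>i<4. \<forall>u<n. dist1 u z = dist1 u (?a i)"
      by (auto intro: exI[of _ 0] exI[of _ 1] exI[of _ 2] exI[of _ 3])
  qed
  then obtain \<phi> where \<phi>: "\<And>z. z < n \<Longrightarrow> \<phi> z < 4 \<and> (\<forall>u<n. dist1 u z = dist1 u (?a (\<phi> z)))"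
    by metis
  have "dist1 u v = entry R (\<phi> u) (\<phi> v)" if "u < n" "v < n" for u v
  proof -
    have "dist1 u v = dist1 u (?a (\<phi> v))" using \<phi> that by blast
    also have "\<dots> = dist1 (?a (\<phi> v)) u" using dist1_sym an \<phi> that by blast
    also have "\<dots> = dist1 (?a (\<phi> v)) (?a (\<phi> u))" using \<phi> that an by blast
    also have "\<dots> = dist1 (?a (\<phi> u)) (?a (\<phi> v))" using dist1_sym an \<phi> that by blast
    finally show ?thesis using R \<phi> that by simp
  qed
  with \<phi> that show thesis by blast
qed

end

context rank4_graph
begin

text \<open>The distances from \<open>z\<close> are unbounded here, so the case analysis runs over
  their differences along the path edges, which lie in \<open>{-1, 0, 1}\<close>. Integers are used
  so that \<open>presburger\<close> can finish it.\<close>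

lemma rows_of_isometric_P4:
  assumes a: "p < n" "q < n" "r < n" "y < n"
    and d: "d p q = 1" "d q r = 1" "d r y = 1" "d p r = 2" "d q y = 2" "d p y = 3"
    and z: "z < n"
  shows "\<exists>w\<in>{p, q, r, y}. \<forall>u<n. dist1 u z = dist1 u w"
proof (cases "z \<in> {p, q, r, y}")
  case False
  have B: "dist1 p q = 1" "dist1 q r = 1" "dist1 r y = 1" "dist1 p r = 2" "dist1 q y = 2" "dist1 p y = 3"
    and distinct: "distinct [p, q, r, y]"
    using d by (auto simp: dist1_def)
  note B' = B[unfolded dist1_sym[OF a(1,2)] dist1_sym[OF a(2,3)] dist1_sym[OF a(3,4)] dist1_sym[OF a(1,3)]
      dist1_sym[OF a(2,4)] dist1_sym[OF a(1,4)]]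
  have "\<exists>(x0 :: real) (x1 :: real) (x2 :: real) (x3 :: real).
      \<forall>u<n. dist1 u z = dist1 u p * x0 + dist1 u q * x1 + dist1 u r * x2 + dist1 u y * x3"
    by (rule column_combination[OF a z distinct]) (simp add: B B')
  then obtain x0 x1 x2 x3 :: real where
    x: "\<And>u. u < n \<Longrightarrow> dist1 u z = dist1 u p * x0 + dist1 u q * x1 + dist1 u r * x2 + dist1 u y * x3"
    by blast
  define b0 b1 b2 b3 where bs:
    "b0 = int (dist1 z p)" "b1 = int (dist1 z q)" "b2 = int (dist1 z r)" "b3 = int (dist1 z y)"
  have edges: "E p q" "E q r" "E r y" using d_eq_1_iff a d by auto
  note lip = dist1_edge_lipschitz[OF _ z]
  have pos: "b0 \<ge> 1" "b1 \<ge> 1" "b2 \<ge> 1" "b3 \<ge> 1" using dist1_pos[OF z] a unfolding bs by auto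
  have \<alpha>: "b0 - b1 \<in> {-1, 0, 1}" and \<beta>: "b1 - b2 \<in> {-1, 0, 1}" and \<gamma>: "b3 - b2 \<in> {-1, 0, 1}"
    using lip[of p q] lip[of q p] lip[of q r] lip[of r q] lip[of r y] lip[of y r] edges edgeD
    unfolding bs by auto
  have sys: "x0 + x1 + 2 * x2 + 3 * x3 = b0" "x0 + x1 + x2 + 2 * x3 = b1"
    "2 * x0 + x1 + x2 + x3 = b2" "3 * x0 + 2 * x1 + x2 + x3 = b3"
    using x[OF a(1)] x[OF a(2)] x[OF a(3)] x[OF a(4)] dist1_sym[OF z] a by (simp_all add: bs B B')
  \<comment> \<open>Row \<open>z\<close> of the relation, whose left side is the diagonal entry
    1.\<close>
  have one: "1 = b0 * x0 + b1 * x1 + b2 * x2 + b3 * x3"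
    using x[OF z] by (simp add: bs)
  have x0: "x0 = b2 - (b3 - b2) - (b0 - b1)" and x3: "x3 = b1 - (b3 - b2) - (b0 - b1)"
    and x1: "x1 = (b3 - b2) - x0" and x2: "x2 = (b0 - b1) - x3"
    using sys by simp_all
  define k l :: int where kl: "k = b0 - b1" "l = b3 - b2"
  \<comment> \<open>The condition \<open>v\<^sup>T S\<^sup>-\<^sup>1 v = 1\<close> in terms of the differences \<open>k\<close>, \<open>l\<close> of consecutive distances.\<close>
  have "1 = real_of_int (2 * k * b2 + 2 * l * b1 - 2 * k * l - k\<^sup>2 - l\<^sup>2)"
    using one unfolding x1 x2 unfolding x0 x3 kl by (simp add: algebra_simps power2_eq_square)
  then have Q: "1 = 2 * k * b2 + 2 * l * b1 - 2 * k * l - k\<^sup>2 - l\<^sup>2"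
    by linarith
  have kl': "k \<in> {-1, 0, 1}" "l \<in> {-1, 0, 1}" using \<alpha> \<gamma> kl by simp_all
  have "(k = 1 \<and> l = 0 \<and> b2 = 1) \<or> (k = 0 \<and> l = 1 \<and> b1 = 1)"
    using kl' pos
    by (elim insertE emptyE) (use Q in \<open>simp_all, presburger+\<close>)
  \<comment> \<open>By \<open>\<beta>\<close> and positivity the other middle distance is 1 or 2,
    which leaves the rows of \<open>r\<close>, \<open>y\<close>, \<open>q\<close> and
    \<open>p\<close>, in this order. Each makes the coefficient vector a unit vector.\<close>
  then have "(b0, b1, b2, b3) \<in> {(2, 1, 1, 1), (3, 2, 1, 1), (1, 1, 1, 2), (1, 1, 2, 3)}"
    using \<beta> pos kl by auto
  then consider "x0 = 0 \<and> x1 = 0 \<and> x2 = 1 \<and> x3 = 0" | "x0 = 0 \<and> x1 = 0 \<and> x2 = 0 \<and> x3 = 1"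
    | "x0 = 0 \<and> x1 = 1 \<and> x2 = 0 \<and> x3 = 0" | "x0 = 1 \<and> x1 = 0 \<and> x2 = 0 \<and> x3 = 0"
    using x0 x1 x2 x3 by auto
  then show ?thesis
    by cases (use x in auto)
qed auto

text \<open>With all distances 1 or 2 there are 16 vectors of distances from \<open>z\<close>.
  Fixing one makes \<open>one\<close> linear as well, and together with \<open>sys\<close> it
  rejects all but the four rows; \<open>rows_of_C4\<close> proceeds in the same way.\<close>

lemma rows_of_K13:
  assumes a: "a0 < n" "a1 < n" "a2 < n" "a3 < n" and z: "z < n"
    and B: "dist1 a0 a1 = 1" "dist1 a0 a2 = 1" "dist1 a0 a3 = 1" "dist1 a1 a2 = 2" "dist1 a1 a3 = 2" "dist1 a2 a3 = 2"
    and diam: "\<And>u v. u < n \<Longrightarrow> v < n \<Longrightarrow> dist1 u v \<in> {1, 2}"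
  shows "\<exists>w\<in>{a0, a1, a2, a3}. \<forall>u<n. dist1 u z = dist1 u w"
proof -
  note B' = B(1)[unfolded dist1_sym[OF a(1,2)]] B(2)[unfolded dist1_sym[OF a(1,3)]] B(3)[unfolded dist1_sym[OF a(1,4)]]
    B(4)[unfolded dist1_sym[OF a(2,3)]] B(5)[unfolded dist1_sym[OF a(2,4)]] B(6)[unfolded dist1_sym[OF a(3,4)]]
  have distinct: "distinct [a0, a1, a2, a3]" using B B' by auto
  have "\<exists>(x0 :: real) (x1 :: real) (x2 :: real) (x3 :: real).
      \<forall>u<n. dist1 u z = dist1 u a0 * x0 + dist1 u a1 * x1 + dist1 u a2 * x2 + dist1 u a3 * x3"
    by (rule column_combination[OF a z distinct]) (simp add: B B')
  then obtain x0 x1 x2 x3 :: real where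
    x: "\<And>u. u < n \<Longrightarrow> dist1 u z = dist1 u a0 * x0 + dist1 u a1 * x1 + dist1 u a2 * x2 + dist1 u a3 * x3"
    by blast
  have sys: "x0 + x1 + x2 + x3 = dist1 z a0" "x0 + x1 + 2 * x2 + 2 * x3 = dist1 z a1"
    "x0 + 2 * x1 + x2 + 2 * x3 = dist1 z a2" "x0 + 2 * x1 + 2 * x2 + x3 = dist1 z a3"
    using x[OF a(1)] x[OF a(2)] x[OF a(3)] x[OF a(4)] dist1_sym[OF z] a by (simp_all add: B B')
  have one: "1 = dist1 z a0 * x0 + dist1 z a1 * x1 + dist1 z a2 * x2 + dist1 z a3 * x3"
    using x[OF z] by simp
  have "dist1 z a0 \<in> {1, 2}" "dist1 z a1 \<in> {1, 2}" "dist1 z a2 \<in> {1, 2}" "dist1 z a3 \<in> {1, 2}"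
    using diam a z by auto
  then consider "x0 = 1 \<and> x1 = 0 \<and> x2 = 0 \<and> x3 = 0" | "x0 = 0 \<and> x1 = 1 \<and> x2 = 0 \<and> x3 = 0"
    | "x0 = 0 \<and> x1 = 0 \<and> x2 = 1 \<and> x3 = 0" | "x0 = 0 \<and> x1 = 0 \<and> x2 = 0 \<and> x3 = 1"
    by (elim insertE emptyE; use sys one in simp; linarith)
  then show ?thesis
    by cases (use x in auto)
qed

lemma rows_of_C4:
  assumes a: "a0 < n" "a1 < n" "a2 < n" "a3 < n" and z: "z < n"
    and B: "dist1 a0 a1 = 1" "dist1 a0 a2 = 2" "dist1 a0 a3 = 1" "dist1 a1 a2 = 1" "dist1 a1 a3 = 2" "dist1 a2 a3 = 1"
    and diam: "\<And>u v. u < n \<Longrightarrow> v < n \<Longrightarrow> dist1 u v \<in> {1, 2}"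
  shows "\<exists>w\<in>{a0, a1, a2, a3}. \<forall>u<n. dist1 u z = dist1 u w"
proof -
  note B' = B(1)[unfolded dist1_sym[OF a(1,2)]] B(2)[unfolded dist1_sym[OF a(1,3)]] B(3)[unfolded dist1_sym[OF a(1,4)]]
    B(4)[unfolded dist1_sym[OF a(2,3)]] B(5)[unfolded dist1_sym[OF a(2,4)]] B(6)[unfolded dist1_sym[OF a(3,4)]]
  have distinct: "distinct [a0, a1, a2, a3]" using B B' by auto
  have "\<exists>(x0 :: real) (x1 :: real) (x2 :: real) (x3 :: real).
      \<forall>u<n. dist1 u z = dist1 u a0 * x0 + dist1 u a1 * x1 + dist1 u a2 * x2 + dist1 u a3 * x3"
    by (rule column_combination[OF a z distinct]) (simp add: B B')
  then obtain x0 x1 x2 x3 :: real where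
    x: "\<And>u. u < n \<Longrightarrow> dist1 u z = dist1 u a0 * x0 + dist1 u a1 * x1 + dist1 u a2 * x2 + dist1 u a3 * x3"
    by blast
  have sys: "x0 + x1 + 2 * x2 + x3 = dist1 z a0" "x0 + x1 + x2 + 2 * x3 = dist1 z a1"
    "2 * x0 + x1 + x2 + x3 = dist1 z a2" "x0 + 2 * x1 + x2 + x3 = dist1 z a3"
    using x[OF a(1)] x[OF a(2)] x[OF a(3)] x[OF a(4)] dist1_sym[OF z] a by (simp_all add: B B')
  have one: "1 = dist1 z a0 * x0 + dist1 z a1 * x1 + dist1 z a2 * x2 + dist1 z a3 * x3"
    using x[OF z] by simp
  have "dist1 z a0 \<in> {1, 2}" "dist1 z a1 \<in> {1, 2}" "dist1 z a2 \<in> {1, 2}" "dist1 z a3 \<in> {1, 2}"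
    using diam a z by auto
  then consider "x0 = 1 \<and> x1 = 0 \<and> x2 = 0 \<and> x3 = 0" | "x0 = 0 \<and> x1 = 1 \<and> x2 = 0 \<and> x3 = 0"
    | "x0 = 0 \<and> x1 = 0 \<and> x2 = 1 \<and> x3 = 0" | "x0 = 0 \<and> x1 = 0 \<and> x2 = 0 \<and> x3 = 1"
    by (elim insertE emptyE; use sys one in simp; linarith)
  then show ?thesis
    by cases (use x in auto)
qed

section \<open>Forbidden induced subgraphs at diameter two\<close>

text \<open>At diameter 2 the ends of an induced path have distance 2 instead of 3. For a common
  neighbour of the ends only the two inner distances are free, and all four choices contradict row
  \<open>z\<close> of the relation.\<close>

lemma P4_ends_no_common_neighbour:
  assumes a: "a0 < n" "a1 < n" "a2 < n" "a3 < n" and z: "z < n"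
    and B: "dist1 a0 a1 = 1" "dist1 a0 a2 = 2" "dist1 a0 a3 = 2" "dist1 a1 a2 = 1" "dist1 a1 a3 = 2" "dist1 a2 a3 = 1"
    and diam: "\<And>u v. u < n \<Longrightarrow> v < n \<Longrightarrow> dist1 u v \<in> {1, 2}"
    and nbr: "dist1 z a0 = 1" "dist1 z a3 = 1"
  shows False
proof -
  note B' = B(1)[unfolded dist1_sym[OF a(1,2)]] B(2)[unfolded dist1_sym[OF a(1,3)]] B(3)[unfolded dist1_sym[OF a(1,4)]]
    B(4)[unfolded dist1_sym[OF a(2,3)]] B(5)[unfolded dist1_sym[OF a(2,4)]] B(6)[unfolded dist1_sym[OF a(3,4)]]
  have distinct: "distinct [a0, a1, a2, a3]" using B B' by auto
  have "\<exists>(x0 :: real) (x1 :: real) (x2 :: real) (x3 :: real).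
      \<forall>u<n. dist1 u z = dist1 u a0 * x0 + dist1 u a1 * x1 + dist1 u a2 * x2 + dist1 u a3 * x3"
    by (rule column_combination[OF a z distinct]) (simp add: B B')
  then obtain x0 x1 x2 x3 :: real where
    x: "\<And>u. u < n \<Longrightarrow> dist1 u z = dist1 u a0 * x0 + dist1 u a1 * x1 + dist1 u a2 * x2 + dist1 u a3 * x3"
    by blast
  have sys: "x0 + x1 + 2 * x2 + 2 * x3 = dist1 z a0" "x0 + x1 + x2 + 2 * x3 = dist1 z a1"
    "2 * x0 + x1 + x2 + x3 = dist1 z a2" "2 * x0 + 2 * x1 + x2 + x3 = dist1 z a3"
    using x[OF a(1)] x[OF a(2)] x[OF a(3)] x[OF a(4)] dist1_sym[OF z] a by (simp_all add: B B')
  have one: "1 = dist1 z a0 * x0 + dist1 z a1 * x1 + dist1 z a2 * x2 + dist1 z a3 * x3"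
    using x[OF z] by simp
  have "dist1 z a1 \<in> {1, 2}" "dist1 z a2 \<in> {1, 2}"
    using diam a z by auto
  then show False
    by (elim insertE emptyE; use sys one nbr in simp; linarith)
qed

text \<open>The path has centre \<open>a0\<close> and the isolated vertex is \<open>a3\<close>.
  Again four choices for the distances from \<open>z\<close> to the path ends remain, all
  contradictory.\<close>

lemma P3_K1_no_common_neighbour:
  assumes a: "a0 < n" "a1 < n" "a2 < n" "a3 < n" and z: "z < n"
    and B: "dist1 a0 a1 = 1" "dist1 a0 a2 = 1" "dist1 a0 a3 = 2" "dist1 a1 a2 = 2" "dist1 a1 a3 = 2" "dist1 a2 a3 = 2"
    and diam: "\<And>u v. u < n \<Longrightarrow> v < n \<Longrightarrow> dist1 u v \<in> {1, 2}"
    and nbr: "dist1 z a0 = 1" "dist1 z a3 = 1"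
  shows False
proof -
  note B' = B(1)[unfolded dist1_sym[OF a(1,2)]] B(2)[unfolded dist1_sym[OF a(1,3)]] B(3)[unfolded dist1_sym[OF a(1,4)]]
    B(4)[unfolded dist1_sym[OF a(2,3)]] B(5)[unfolded dist1_sym[OF a(2,4)]] B(6)[unfolded dist1_sym[OF a(3,4)]]
  have distinct: "distinct [a0, a1, a2, a3]" using B B' by auto
  have "\<exists>(x0 :: real) (x1 :: real) (x2 :: real) (x3 :: real).
      \<forall>u<n. dist1 u z = dist1 u a0 * x0 + dist1 u a1 * x1 + dist1 u a2 * x2 + dist1 u a3 * x3"
    by (rule column_combination[OF a z distinct]) (simp add: B B')
  then obtain x0 x1 x2 x3 :: real where
    x: "\<And>u. u < n \<Longrightarrow> dist1 u z = dist1 u a0 * x0 + dist1 u a1 * x1 + dist1 u a2 * x2 + dist1 u a3 * x3"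
    by blast
  have sys: "x0 + x1 + x2 + 2 * x3 = dist1 z a0" "x0 + x1 + 2 * x2 + 2 * x3 = dist1 z a1"
    "x0 + 2 * x1 + x2 + 2 * x3 = dist1 z a2" "2 * x0 + 2 * x1 + 2 * x2 + x3 = dist1 z a3"
    using x[OF a(1)] x[OF a(2)] x[OF a(3)] x[OF a(4)] dist1_sym[OF z] a by (simp_all add: B B')
  have one: "1 = dist1 z a0 * x0 + dist1 z a1 * x1 + dist1 z a2 * x2 + dist1 z a3 * x3"
    using x[OF z] by simp
  have "dist1 z a1 \<in> {1, 2}" "dist1 z a2 \<in> {1, 2}"
    using diam a z by auto
  then show False
    by (elim insertE emptyE; use sys one nbr in simp; linarith)
qed

text \<open>
  Classes may be empty: complete graphs and blow-ups of \<open>P\<^sub>3\<close> are counted as blow-ups of \<open>K\<^sub>1\<^sub>,\<^sub>3\<close>.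
\<close>

lemma diameter_2_classification:
  assumes diam: "\<And>u v. u < n \<Longrightarrow> v < n \<Longrightarrow> dist1 u v \<in> {1, 2}"
  obtains R \<phi> where "R = K13_rows \<or> R = C4_rows" "\<And>u. u < n \<Longrightarrow> \<phi> u < 4"
    "\<And>u v. u < n \<Longrightarrow> v < n \<Longrightarrow> dist1 u v = entry R (\<phi> u) (\<phi> v)"
proof -
  have one_or_two: "dist1 u v = 1 \<or> dist1 u v = 2" if "u < n" "v < n" for u v
    using diam[OF that] by simp
  have common: "\<exists>z<n. dist1 z u = 1 \<and> dist1 z v = 1" if uv: "u < n" "v < n" "dist1 u v = 2" for u v
  proof -
    have "d u v = 2" using uv by (simp add: dist1_def split: if_splits)
    then obtain z where "z < n" "E u z" "E z v" using d_eq_2_ex uv by blast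
    then show ?thesis using dist1_eq_1_iff edgeD uv by blast
  qed
  have no_P4: False
    if "p < n" "q < n" "r < n" "y < n" "dist1 p q = 1" "dist1 p r = 2" "dist1 p y = 2" "dist1 q r = 1" "dist1 q y = 2" "dist1 r y = 1"
    for p q r y
    using common[OF that(1,4,7)] P4_ends_no_common_neighbour[OF that(1-4) _ that(5-10) diam] by blast
  have no_P3_K1: False
    if "c < n" "x < n" "y < n" "w < n" "dist1 c x = 1" "dist1 c y = 1" "dist1 c w = 2" "dist1 x y = 2" "dist1 x w = 2" "dist1 y w = 2"
    for c x y w
    using common[OF that(1,4,7)] P3_K1_no_common_neighbour[OF that(1-4) _ that(5-10) diam] by blast
  show thesis
  \<comment> \<open>An induced \<open>C4\<close> or, failing that, an induced claw settles the
    structure by its row lemma. Otherwise all four induced subgraphs are absent.\<close>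
  proof (cases "\<exists>a0 a1 a2 a3. a0 < n \<and> a1 < n \<and> a2 < n \<and> a3 < n \<and> dist1 a0 a1 = 1 \<and> dist1 a0 a2 = 2 \<and> dist1 a0 a3 = 1
      \<and> dist1 a1 a2 = 1 \<and> dist1 a1 a3 = 2 \<and> dist1 a2 a3 = 1")
    case True
    then obtain a0 a1 a2 a3 where a: "a0 < n" "a1 < n" "a2 < n" "a3 < n"
      and B: "dist1 a0 a1 = 1" "dist1 a0 a2 = 2" "dist1 a0 a3 = 1" "dist1 a1 a2 = 1" "dist1 a1 a3 = 2" "dist1 a2 a3 = 1"
      by blast
    have entries: "dist1 ([a0, a1, a2, a3] ! i) ([a0, a1, a2, a3] ! j) = entry C4_rows i j" if "i < 4" "j < 4" for i j
      using that a B dist1_sym by (auto simp: less_4_cases entry_def C4_rows_def)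
    obtain \<phi> where "\<And>u. u < n \<Longrightarrow> \<phi> u < 4"
      "\<And>u v. u < n \<Longrightarrow> v < n \<Longrightarrow> dist1 u v = entry C4_rows (\<phi> u) (\<phi> v)"
      using blowup_of_rows[OF a rows_of_C4[OF a _ B diam] entries] by blast
    then show ?thesis using that by blast
  next
    case no_C4: False
    show ?thesis
    proof (cases "\<exists>a0 a1 a2 a3. a0 < n \<and> a1 < n \<and> a2 < n \<and> a3 < n \<and> dist1 a0 a1 = 1 \<and> dist1 a0 a2 = 1 \<and> dist1 a0 a3 = 1
        \<and> dist1 a1 a2 = 2 \<and> dist1 a1 a3 = 2 \<and> dist1 a2 a3 = 2")
      case True
      then obtain a0 a1 a2 a3 where a: "a0 < n" "a1 < n" "a2 < n" "a3 < n"
        and B: "dist1 a0 a1 = 1" "dist1 a0 a2 = 1" "dist1 a0 a3 = 1" "dist1 a1 a2 = 2" "dist1 a1 a3 = 2" "dist1 a2 a3 = 2"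
        by blast
      have entries: "dist1 ([a0, a1, a2, a3] ! i) ([a0, a1, a2, a3] ! j) = entry K13_rows i j" if "i < 4" "j < 4" for i j
        using that a B dist1_sym by (auto simp: less_4_cases entry_def K13_rows_def)
      obtain \<phi> where "\<And>u. u < n \<Longrightarrow> \<phi> u < 4"
        "\<And>u v. u < n \<Longrightarrow> v < n \<Longrightarrow> dist1 u v = entry K13_rows (\<phi> u) (\<phi> v)"
        using blowup_of_rows[OF a rows_of_K13[OF a _ B diam] entries] by blast
      then show ?thesis using that by blast
    next
      case no_K13: False
      show ?thesis
      proof (cases "\<exists>x y. x < n \<and> y < n \<and> dist1 x y = 2")
        case False
        then have "dist1 u v = 1" if "u < n" "v < n" for u v using one_or_two that by blast
        \<comment> \<open>The graph is complete: every vertex goes to the class of the claw's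
          centre.\<close>
        then show ?thesis
          by (intro that[of K13_rows "\<lambda>_. 0"]) (auto simp: entry_def K13_rows_def)
      next
        case True
        then obtain x y where xy: "x < n" "y < n" "dist1 x y = 2" by blast
        obtain c where c: "c < n" "dist1 c x = 1" "dist1 c y = 1" using common[OF xy] by blast
        have xc: "dist1 x c = 1" and yx: "dist1 y x = 2" using c xy dist1_sym by metis+
        \<comment> \<open>A vertex \<open>w\<close> far from both would form an induced claw with
          \<open>c\<close>, \<open>x\<close>, \<open>y\<close> if adjacent to \<open>c\<close>, and
          an induced \<open>P3 + K1\<close> if not.\<close>
        have adj: "dist1 x w = 1 \<or> dist1 y w = 1" if "w < n" for w
        proof (rule ccontr)
          assume "\<not> ?thesis"
          then have 2: "dist1 x w = 2" "dist1 y w = 2" using one_or_two that xy by blast+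
          show False
            using one_or_two[OF c(1) that] no_P3_K1[OF c(1) xy(1,2) that c(2,3) _ xy(3) 2] no_K13 c xy that 2
            by blast
        qed
        \<comment> \<open>Class 0 holds the common neighbours of \<open>x\<close> and
          \<open>y\<close>, class 1 the rest of the closed neighbourhood of \<open>x\<close>, class
          2 that of \<open>y\<close>; class 3 stays empty. The next four facts hold because a wrong
          adjacency would create an induced \<open>P3 + K1\<close>, \<open>P4\<close>,
          \<open>C4\<close> and \<open>P4\<close>, respectively.\<close>
        define \<phi> where "\<phi> w = (if dist1 x w = 1 then if dist1 y w = 1 then 0 else 1 else 2 :: nat)" for w
        have private_clique: "dist1 u v = 1"
          if "s < n" "t < n" "dist1 s t = 2" "u < n" "v < n" "dist1 s u = 1" "dist1 s v = 1" "dist1 t u = 2" "dist1 t v = 2" for s t u v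
        proof (rule ccontr)
          assume "dist1 u v \<noteq> 1"
          then have "dist1 u v = 2" using one_or_two that by blast
          then show False
            using no_P3_K1[of s u v t] that dist1_sym by metis
        qed
        have common_private: "dist1 u v = 1"
          if "s < n" "t < n" "dist1 s t = 2" "u < n" "v < n" "dist1 s u = 1" "dist1 s v = 1" "dist1 t u = 2" "dist1 t v = 1" for s t u v
        proof (rule ccontr)
          assume "dist1 u v \<noteq> 1"
          then have "dist1 u v = 2" using one_or_two that by blast
          then show False
            using no_P4[of u s v t] that dist1_sym by metis
        qed
        have common_clique: "dist1 u v = 1"
          if "u < n" "v < n" "dist1 x u = 1" "dist1 x v = 1" "dist1 y u = 1" "dist1 y v = 1" for u v
        proof (rule ccontr)
          assume "dist1 u v \<noteq> 1"
          then have "dist1 u v = 2" using one_or_two that by blast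
          then show False
            using no_C4 that xy dist1_sym by metis
        qed
        have private_apart: "dist1 u v = 2"
          if "u < n" "v < n" "dist1 x u = 1" "dist1 x v = 2" "dist1 y u = 2" "dist1 y v = 1" for u v
        proof (rule ccontr)
          assume "dist1 u v \<noteq> 2"
          then have "dist1 u v = 1" using one_or_two that by blast
          then show False
            using no_P4[of x u v y] that xy dist1_sym by metis
        qed
        have "dist1 u v = entry K13_rows (\<phi> u) (\<phi> v)" if uv: "u < n" "v < n" for u v
        proof -
          have bvu: "dist1 v u = dist1 u v" using dist1_sym uv by blast
          consider (common) "dist1 x u = 1" "dist1 y u = 1" | (x) "dist1 x u = 1" "dist1 y u = 2" | (y) "dist1 x u = 2" "dist1 y u = 1"
            using adj[OF uv(1)] one_or_two[OF xy(1) uv(1)] one_or_two[OF xy(2) uv(1)] by fastforce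
          then show ?thesis
          proof cases
            case common
            note u = this
            consider (common) "dist1 x v = 1" "dist1 y v = 1" | (x) "dist1 x v = 1" "dist1 y v = 2" | (y) "dist1 x v = 2" "dist1 y v = 1"
              using adj[OF uv(2)] one_or_two[OF xy(1) uv(2)] one_or_two[OF xy(2) uv(2)] by fastforce
            then show ?thesis
            proof cases
              case common
              then have "dist1 u v = 1"
                using common_clique[OF uv] u bvu by simp
              with u common show ?thesis
                by (simp add: \<phi>_def entry_def K13_rows_def)
            next
              case x
              then have "dist1 u v = 1"
                using common_private[OF xy uv(2,1)] u bvu by simp
              with u x show ?thesis
                by (simp add: \<phi>_def entry_def K13_rows_def)
            next
              case y
              then have "dist1 u v = 1"
                using common_private[OF xy(2,1) yx uv(2,1)] u bvu by simp
              with u y show ?thesis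
                by (simp add: \<phi>_def entry_def K13_rows_def)
            qed
          next
            case x
            note u = this
            consider (common) "dist1 x v = 1" "dist1 y v = 1" | (x) "dist1 x v = 1" "dist1 y v = 2" | (y) "dist1 x v = 2" "dist1 y v = 1"
              using adj[OF uv(2)] one_or_two[OF xy(1) uv(2)] one_or_two[OF xy(2) uv(2)] by fastforce
            then show ?thesis
            proof cases
              case common
              then have "dist1 u v = 1"
                using common_private[OF xy uv] u bvu by simp
              with u common show ?thesis
                by (simp add: \<phi>_def entry_def K13_rows_def)
            next
              case x
              then have "dist1 u v = 1"
                using private_clique[OF xy uv] u bvu by simp
              with u x show ?thesis
                by (simp add: \<phi>_def entry_def K13_rows_def)
            next
              case y
              then have "dist1 u v = 2"
                using private_apart[OF uv] u bvu by simp
              with u y show ?thesis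
                by (simp add: \<phi>_def entry_def K13_rows_def)
            qed
          next
            case y
            note u = this
            consider (common) "dist1 x v = 1" "dist1 y v = 1" | (x) "dist1 x v = 1" "dist1 y v = 2" | (y) "dist1 x v = 2" "dist1 y v = 1"
              using adj[OF uv(2)] one_or_two[OF xy(1) uv(2)] one_or_two[OF xy(2) uv(2)] by fastforce
            then show ?thesis
            proof cases
              case common
              then have "dist1 u v = 1"
                using common_private[OF xy(2,1) yx uv] u bvu by simp
              with u common show ?thesis
                by (simp add: \<phi>_def entry_def K13_rows_def)
            next
              case x
              then have "dist1 u v = 2"
                using private_apart[OF uv(2,1)] u bvu by simp
              with u x show ?thesis
                by (simp add: \<phi>_def entry_def K13_rows_def)
            next
              case y
              then have "dist1 u v = 1"
                using private_clique[OF xy(2,1) yx uv] u bvu by simp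
              with u y show ?thesis
                by (simp add: \<phi>_def entry_def K13_rows_def)
            qed
          qed
        qed
        moreover have "\<phi> u < 4" for u by (simp add: \<phi>_def)
        ultimately show ?thesis using that by blast
      qed
    qed
  qed
qed

end

section \<open>Class sizes\<close>

text \<open>Up to sign, the coefficients are sums of principal minors weighted by products of class
  sizes. A pair of classes at distance \<open>k\<close> contributes \<open>1 - k\<^sup>2\<close>,
  hence the constants 3 and 8.\<close>

lemma char_poly_quotient_P4:
  "poly (char_poly (quotient_mat 4 (\<lambda>i j. real (entry P4_rows i j)) n \<phi>)) x =
   (let A = real (class_size n \<phi> 0); B = real (class_size n \<phi> 1);
         C = real (class_size n \<phi> 2); D = real (class_size n \<phi> 3) in
    x ^ 4 - (A + B + C + D) * x ^ 3 - (3 * A * C + 3 * B * D + 8 * A * D) * x ^ 2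
    + (A * B * C + A * B * D + A * C * D + B * C * D) * x + A * B * C * D)"
proof -
  let ?Q = "quotient_mat 4 (\<lambda>i j. real (entry P4_rows i j)) n \<phi>"
  have Q: "?Q \<in> carrier_mat 4 4" "x \<cdot>\<^sub>m 1\<^sub>m 4 - ?Q \<in> carrier_mat 4 4"
    by (simp_all add: quotient_mat_def minus_carrier_mat)
  show ?thesis
    unfolding poly_char_poly_det[OF Q(1)] det_4x4[OF Q(2)]
    by (simp add: quotient_mat_def entry_def P4_rows_def Let_def)
       (simp add: algebra_simps power4_eq_xxxx power3_eq_cube power2_eq_square)
qed

lemma char_poly_quotient_K13:
  "poly (char_poly (quotient_mat 4 (\<lambda>i j. real (entry K13_rows i j)) n \<phi>)) x =
   (let A = real (class_size n \<phi> 0); B = real (class_size n \<phi> 1);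
         C = real (class_size n \<phi> 2); D = real (class_size n \<phi> 3) in
    x ^ 4 - (A + B + C + D) * x ^ 3 - (3 * B * C + 3 * B * D + 3 * C * D) * x ^ 2
    + (A * B * C + A * B * D + A * C * D - 5 * B * C * D) * x + 2 * A * B * C * D)"
proof -
  let ?Q = "quotient_mat 4 (\<lambda>i j. real (entry K13_rows i j)) n \<phi>"
  have Q: "?Q \<in> carrier_mat 4 4" "x \<cdot>\<^sub>m 1\<^sub>m 4 - ?Q \<in> carrier_mat 4 4"
    by (simp_all add: quotient_mat_def minus_carrier_mat)
  show ?thesis
    unfolding poly_char_poly_det[OF Q(1)] det_4x4[OF Q(2)]
    by (simp add: quotient_mat_def entry_def K13_rows_def Let_def)
       (simp add: algebra_simps power4_eq_xxxx power3_eq_cube power2_eq_square)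
qed

lemma char_poly_quotient_C4:
  "poly (char_poly (quotient_mat 4 (\<lambda>i j. real (entry C4_rows i j)) n \<phi>)) x =
   (let A = real (class_size n \<phi> 0); B = real (class_size n \<phi> 1);
         C = real (class_size n \<phi> 2); D = real (class_size n \<phi> 3) in
    x ^ 4 - (A + B + C + D) * x ^ 3 - (3 * A * C + 3 * B * D) * x ^ 2
    + (A * B * C + A * B * D + A * C * D + B * C * D) * x + 5 * A * B * C * D)"
proof -
  let ?Q = "quotient_mat 4 (\<lambda>i j. real (entry C4_rows i j)) n \<phi>"
  have Q: "?Q \<in> carrier_mat 4 4" "x \<cdot>\<^sub>m 1\<^sub>m 4 - ?Q \<in> carrier_mat 4 4"
    by (simp_all add: quotient_mat_def minus_carrier_mat)
  show ?thesis
    unfolding poly_char_poly_det[OF Q(1)] det_4x4[OF Q(2)]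
    by (simp add: quotient_mat_def entry_def C4_rows_def Let_def)
       (simp add: algebra_simps power4_eq_xxxx power3_eq_cube power2_eq_square)
qed

section \<open>Comparing the coefficients of the quartics\<close>

lemma quartic_coefficients:
  fixes a b c d a' b' c' d' :: real
  assumes "\<And>x. x ^ 4 - a * x ^ 3 - b * x ^ 2 + c * x + d = x ^ 4 - a' * x ^ 3 - b' * x ^ 2 + c' * x + d'"
  shows "a = a'" "b = b'" "c = c'" "d = d'"
  \<comment> \<open>The quartic terms cancel, and a cubic is determined by its values at four
    points.\<close>
  using assms[of 0] assms[of 1] assms[of "-1"] assms[of 2] by simp_all

text \<open>The quartic for the sizes \<open>a, b, c, d\<close> agrees with the one for
  \<open>p, 1, 1, q\<close>. First \<open>b * c = 1\<close> is forced; then \<open>a\<close> and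
  \<open>d\<close> have the same sum and product as \<open>p\<close> and \<open>q\<close>.\<close>

lemma P4_sizes:
  fixes a b c d p q :: int
  assumes pos: "a \<ge> 1" "b \<ge> 1" "c \<ge> 1" "d \<ge> 1"
    and e1: "a + b + c + d = p + q + 2"
    and e2: "3 * a * c + 3 * b * d + 8 * a * d = 3 * p + 3 * q + 8 * p * q"
    and e3: "a * b * c + a * b * d + a * c * d + b * c * d = p + q + 2 * p * q"
    and e4: "a * b * c * d = p * q"
  shows "b = 1 \<and> c = 1 \<and> (a = p \<and> d = q \<or> a = q \<and> d = p)"
proof -
  let ?w = "(b - 1) * (c - 1)"
  have pq: "p + q = a + b + c + d - 2" using e1 by simp
  \<comment> \<open>The equation \<open>e2\<close> after eliminating \<open>p + q\<close> by
    \<open>e1\<close> and \<open>p * q\<close> by \<open>e4\<close>.\<close>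
  have E2: "3 * (a * c + b * d - a - b - c - d + 2) = 8 * (a * d) * (b * c - 1)"
    using e2 pq e4 by (simp add: algebra_simps)
  \<comment> \<open>\<open>e3\<close> and \<open>e4\<close> combine into a vanishing sum of two nonnegative terms.\<close>
  have "(b * c - 1) * ((a - 1) * (d - 1)) + ?w * (a * d - 1) = 0"
    using e3 pq e4 by (simp add: algebra_simps)
  moreover have "0 \<le> (b * c - 1) * ((a - 1) * (d - 1))" "0 \<le> ?w * (a * d - 1)"
    using pos mult_mono[of 1 b 1 c] mult_mono[of 1 a 1 d] by (auto intro!: mult_nonneg_nonneg)
  ultimately have zero: "(b * c - 1) * ((a - 1) * (d - 1)) = 0" "?w * (a * d - 1) = 0" by linarith+
  have bc: "b * c = 1"
  proof (rule ccontr)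
    assume bc: "b * c \<noteq> 1"
    with zero(1) have ad: "a = 1 \<or> d = 1" by auto
    have "a * d \<noteq> 1"
    proof
      assume "a * d = 1"
      then have "a = 1" "d = 1" using pos ad by auto
      with E2 bc show False by (simp add: algebra_simps)
    qed
    with zero(2) consider "b = 1" | "c = 1" by auto
    then show False
    proof cases
      case 1
      \<comment> \<open>For \<open>b = 1\<close> both sides of \<open>E2\<close> contain the factor
        \<open>c - 1\<close>, which is nonzero; cancelling it leaves an equation that
        \<open>a * d \<ge> a\<close> refutes.\<close>
      with E2 have "(3 * (a - 1) - 8 * (a * d)) * (c - 1) = 0" by (simp add: algebra_simps)
      with 1 bc have "3 * (a - 1) = 8 * (a * d)" by auto
      moreover have "a * 1 \<le> a * d" using pos by (intro mult_left_mono) auto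
      moreover define m where "m = a * d"
      ultimately show False using pos by simp
    next
      case 2
      with E2 have "(3 * (d - 1) - 8 * (a * d)) * (b - 1) = 0" by (simp add: algebra_simps)
      with 2 bc have "3 * (d - 1) = 8 * (a * d)" by auto
      moreover have "1 * d \<le> a * d" using pos by (intro mult_right_mono) auto
      moreover define m where "m = a * d"
      ultimately show False using pos by simp
    qed
  qed
  with pos have b: "b = 1" "c = 1" by (auto simp: zmult_eq_1_iff)
  \<comment> \<open>Equal sums and products make \<open>a\<close> a root of the quadratic with roots
    \<open>p\<close> and \<open>q\<close>.\<close>
  with pq e4 have "(a - p) * (a - q) = 0" 
    by (simp add: algebra_simps) (metis add_diff_cancel_left' distrib_left mult.commute)
  with b pq show ?thesis by auto
qed

text \<open>A nonzero product rules out empty classes. Then the left side of \<open>e2\<close> is at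
  most \<open>9 * b * c * d\<close>, while the right side exceeds
  \<open>8 * p * q = 16 * a * b * c * d\<close>.\<close>

lemma K13_sizes:
  fixes a b c d p q :: int
  assumes nonneg: "a \<ge> 0" "b \<ge> 0" "c \<ge> 0" "d \<ge> 0" and pos: "p \<ge> 1" "q \<ge> 1"
    and e2: "3 * b * c + 3 * b * d + 3 * c * d = 3 * p + 3 * q + 8 * p * q"
    and e4: "2 * a * b * c * d = p * q"
  shows False
proof -
  have "p * q > 0" using pos by simp
  with e4 nonneg have pos': "a \<ge> 1" "b \<ge> 1" "c \<ge> 1" "d \<ge> 1"
    by (metis int_one_le_iff_zero_less less_le mult_eq_0_iff)+
  have "b * c * 1 \<le> b * c * d" "b * d * 1 \<le> b * d * c" "c * d * 1 \<le> c * d * b"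
    using pos' by (auto intro!: mult_left_mono)
  then have le: "b * c \<le> b * c * d" "b * d \<le> b * c * d" "c * d \<le> b * c * d"
    by (simp_all add: mult_ac)
  have "1 * (b * c * d) \<le> a * (b * c * d)" using pos' by (intro mult_right_mono) auto
  moreover have "0 < b * c * d" using pos' by simp
  ultimately show False using le e2 e4 pos by (simp add: mult.assoc)
qed

text \<open>As for the claw: the left side of \<open>e2\<close> is at most
  \<open>6 * a * b * c * d\<close>, the right side exceeds
  \<open>40 * a * b * c * d\<close>.\<close>

lemma C4_sizes:
  fixes a b c d p q :: int
  assumes nonneg: "a \<ge> 0" "b \<ge> 0" "c \<ge> 0" "d \<ge> 0" and pos: "p \<ge> 1" "q \<ge> 1"
    and e2: "3 * a * c + 3 * b * d = 3 * p + 3 * q + 8 * p * q"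
    and e4: "5 * a * b * c * d = p * q"
  shows False
proof -
  have "p * q > 0" using pos by simp
  with e4 nonneg have pos': "a \<ge> 1" "b \<ge> 1" "c \<ge> 1" "d \<ge> 1"
    by (metis int_one_le_iff_zero_less less_le mult_eq_0_iff)+
  have "a * c * 1 \<le> a * c * (b * d)" "b * d * 1 \<le> b * d * (a * c)"
    using pos' mult_mono[of 1 b 1 d] mult_mono[of 1 a 1 c] by (auto intro!: mult_left_mono)
  moreover have "a * c * (b * d) = a * b * c * d" "b * d * (a * c) = a * b * c * d" by simp_all
  moreover have "0 < a * b * c * d" using pos' by simp
  ultimately show False using e2 e4 pos by (simp add: mult.assoc)
qed

section \<open>The two cliques joined by an edge\<close>

text \<open>Bijections between corresponding classes are glued together; adjacency depends only on
  the classes and on distinctness, so the result is an isomorphism.\<close>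

lemma graph_iso_of_blowups:
  assumes \<phi>: "\<And>u. u < n \<Longrightarrow> \<phi> u < k" and \<psi>: "\<And>u. u < n \<Longrightarrow> \<psi> u < k"
    and size: "\<And>i. i < k \<Longrightarrow> class_size n \<phi> i = class_size n \<psi> i"
    and E: "\<And>u v. u < n \<Longrightarrow> v < n \<Longrightarrow> E u v \<longleftrightarrow> u \<noteq> v \<and> P (\<phi> u) (\<phi> v)"
    and F: "\<And>u v. u < n \<Longrightarrow> v < n \<Longrightarrow> F u v \<longleftrightarrow> u \<noteq> v \<and> P (\<psi> u) (\<psi> v)"
  shows "graph_iso n E n F"
proof -
  let ?C = "\<lambda>\<phi> i. {u. u < n \<and> \<phi> u = i}"
  have "\<exists>g. bij_betw g (?C \<phi> i) (?C \<psi> i)" if "i < k" for i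
    using size[OF that] by (intro finite_same_card_bij) (auto simp: class_size_def)
  then obtain g where g: "\<And>i. i < k \<Longrightarrow> bij_betw (g i) (?C \<phi> i) (?C \<psi> i)" by metis
  define f where "f u = g (\<phi> u) u" for u
  have f: "f u < n \<and> \<psi> (f u) = \<phi> u" if "u < n" for u
    using bij_betwE[OF g[OF \<phi>[OF that]]] that by (auto simp: f_def)
  have "inj_on f {..<n}"
  proof (rule inj_onI)
    fix u v assume uv: "u \<in> {..<n}" "v \<in> {..<n}" "f u = f v"
    then have "\<phi> u = \<phi> v" using f by (metis lessThan_iff)
    moreover have "inj_on (g (\<phi> u)) (?C \<phi> (\<phi> u))" using g \<phi> uv by (auto simp: bij_betw_def)
    ultimately show "u = v" using uv by (auto simp: f_def dest: inj_onD)
  qed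
  moreover have "f ` {..<n} \<subseteq> {..<n}" using f by auto
  ultimately have bij: "bij_betw f {..<n} {..<n}"
    by (simp add: bij_betw_def endo_inj_surj)
  moreover have "E u v \<longleftrightarrow> F (f u) (f v)" if "u < n" "v < n" for u v
    using E[OF that] F[of "f u" "f v"] f that bij by (auto simp: bij_betw_def inj_on_def)
  ultimately show ?thesis unfolding graph_iso_def by blast
qed

lemma simple_Kst: "simple_graph (s + t) (Kst s t)"
  by (auto simp: simple_graph_def Kst_def)

lemma connected_Kst:
  assumes "s \<ge> 2" "t \<ge> 2"
  shows "connected_graph (s + t) (Kst s t)"
proof -
  let ?R = "(Kst s t)\<^sup>*\<^sup>*"
  have edge: "?R i j" if "Kst s t i j" for i j using that by blast
  have 0: "?R i 0 \<and> ?R 0 i" if "i < s + t" for i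
  proof -
    have s0: "?R s 0" "?R 0 s" using assms by (auto intro!: edge simp: Kst_def)
    consider "i = 0" | "0 < i" "i < s" | "i = s" | "s < i" by linarith
    then show ?thesis
    proof cases
      case 2
      then show ?thesis using assms by (auto intro!: edge simp: Kst_def)
    next
      case 4
      then have "?R i s" "?R s i" using that by (auto intro!: edge simp: Kst_def)
      with s0 show ?thesis by (auto intro: rtranclp_trans)
    qed (use s0 in auto)
  qed
  have "?R i j" if "i < s + t" "j < s + t" for i j
    using 0 that by (meson rtranclp_trans)
  then show ?thesis
    using assms by (auto simp: connected_graph_def rtranclp_power)
qed

text \<open>The classes are numbered along the path: the ends 0 and \<open>s\<close> of the joining
  edge form the two inner singletons.\<close>

definition Kst_class :: "nat \<Rightarrow> nat \<Rightarrow> nat" where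
  "Kst_class s i = (if i = 0 then 1 else if i < s then 0 else if i = s then 2 else 3)"

lemma class_size_Kst_class:
  assumes "s \<ge> 2" "t \<ge> 2"
  shows "class_size (s + t) (Kst_class s) 0 = s - 1" "class_size (s + t) (Kst_class s) 1 = 1"
    "class_size (s + t) (Kst_class s) 2 = 1" "class_size (s + t) (Kst_class s) 3 = t - 1"
proof -
  have "{u. u < s + t \<and> Kst_class s u = 0} = {1..<s}" "{u. u < s + t \<and> Kst_class s u = 1} = {0}"
    "{u. u < s + t \<and> Kst_class s u = 2} = {s}" "{u. u < s + t \<and> Kst_class s u = 3} = {s<..<s + t}"
    using assms by (auto simp: Kst_class_def split: if_splits)
  then show "class_size (s + t) (Kst_class s) 0 = s - 1" "class_size (s + t) (Kst_class s) 1 = 1"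
    "class_size (s + t) (Kst_class s) 2 = 1" "class_size (s + t) (Kst_class s) 3 = t - 1"
    by (simp_all add: class_size_def)
qed

lemma Kst_iff_class:
  assumes "s \<ge> 2" "t \<ge> 2" "i < s + t" "j < s + t"
  shows "Kst s t i j \<longleftrightarrow> i \<noteq> j \<and> entry P4_rows (Kst_class s i) (Kst_class s j) = 1"
  using assms by (auto simp: Kst_def Kst_class_def entry_def P4_rows_def)

lemma Kst_dist1:
  assumes st: "s \<ge> 2" "t \<ge> 2" and ij: "i < s + t" "j < s + t"
  shows "conn_graph.dist1 (Kst s t) i j = entry P4_rows (Kst_class s i) (Kst_class s j)"
proof -
  interpret conn_graph "s + t" "Kst s t"
    using simple_Kst connected_Kst[OF st] by unfold_locales
  have edge: "d i j = 1" if "Kst s t i j" for i j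
    using that d_eq_1_iff edgeD by blast
  have non_edge: "d i j \<ge> 2" if "i < s + t" "j < s + t" "i \<noteq> j" "\<not> Kst s t i j" for i j
  proof -
    have "d i j \<noteq> 0" "d i j \<noteq> 1" using that d_eq_0_iff d_eq_1_iff by blast+
    then show ?thesis by linarith
  qed
  have s0: "d 0 s = 1" using st by (intro edge) (auto simp: Kst_def)
  \<comment> \<open>In the fact names, \<open>A\<close> stands for the first clique without 0 and
    \<open>B\<close> for the second without \<open>s\<close>. Upper bounds come from routes over the
    joining edge, lower bounds from missing edges and, for distance 3, from a missing common
    neighbour.\<close>
  have As: "d i s = 2" if "0 < i" "i < s" for i
  proof -
    have "d i 0 = 1" using that st by (intro edge) (auto simp: Kst_def)
    with s0 have "d i s \<le> 2" using d_triangle[of i 0 s] that st by simp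
    moreover have "d i s \<ge> 2" using that st by (intro non_edge) (auto simp: Kst_def)
    ultimately show ?thesis by simp
  qed
  have sB: "d s j = 1" if "s < j" "j < s + t" for j
    using that st by (intro edge) (auto simp: Kst_def)
  have B0: "d 0 j = 2" if "s < j" "j < s + t" for j
  proof -
    have "d 0 j \<le> 2" using d_triangle[of 0 s j] s0 sB[OF that] that st by simp
    moreover have "d 0 j \<ge> 2" using that st by (intro non_edge) (auto simp: Kst_def)
    ultimately show ?thesis by simp
  qed
  have AB: "d i j = 3" if "0 < i" "i < s" "s < j" "j < s + t" for i j
  proof -
    have "d i j \<le> 3" using d_triangle[of i s j] As[OF that(1,2)] sB[OF that(3,4)] that st by simp
    moreover have "d i j \<ge> 2" using that st by (intro non_edge) (auto simp: Kst_def)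
    moreover have "d i j \<noteq> 2"
      using d_eq_2_ex[of i j] that by (auto simp: Kst_def)
    ultimately show ?thesis by simp
  qed
  have less: "dist1 i j = entry P4_rows (Kst_class s i) (Kst_class s j)" if "i < j" "j < s + t" for i j
  proof (cases "Kst s t i j")
    case True
    then show ?thesis
      using edge[OF True] Kst_iff_class[OF st, of i j] that by (simp add: dist1_def)
  next
    case False
    then have "i < s" "s \<le> j" "i \<noteq> 0 \<or> j \<noteq> s" using that st by (auto simp: Kst_def)
    then consider "0 < i" "i < s" "j = s" | "i = 0" "s < j" | "0 < i" "i < s" "s < j"
      by (cases "i = 0"; cases "j = s") simp_all
    then show ?thesis
      by cases (use that As B0 AB st in \<open>auto simp: dist1_def Kst_class_def entry_def P4_rows_def\<close>)
  qed
  have P4_sym: "entry P4_rows x y = entry P4_rows y x" if "x < 4" "y < 4" for x y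
    using that by (auto simp: less_4_cases entry_def P4_rows_def)
  have lt4: "Kst_class s i < 4" for i by (simp add: Kst_class_def)
  consider "i < j" | "i = j" | "j < i" by linarith
  then show ?thesis
  proof cases
    case 3
    then show ?thesis using less[OF 3 ij(1)] dist1_sym[OF ij] P4_sym[OF lt4 lt4] by simp
  qed (use less ij lt4[of i] in \<open>auto simp: less_4_cases entry_def P4_rows_def\<close>)
qed

lemma Kst_distance_matrix:
  assumes st: "s \<ge> 2" "t \<ge> 2" and ij: "i < s + t" "j < s + t"
  shows "distance_matrix (s + t) (Kst s t) $$ (i, j) + (if i = j then 1 else 0)
    = real (entry P4_rows (Kst_class s i) (Kst_class s j))"
proof -
  interpret conn_graph "s + t" "Kst s t"
    using simple_Kst connected_Kst[OF st] by unfold_locales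
  show ?thesis using distance_matrix_dist1[OF ij] Kst_dist1[OF st ij] by simp
qed

text \<open>Since \<open>s + t \<ge> 4\<close>, the factor \<open>[:1, 1:] ^ 4\<close> cancels in
  the blow-up formula for four classes.\<close>

lemma Kst_eigenvalue_minus_1:
  assumes st: "s \<ge> 2" "t \<ge> 2"
  shows "[:1, 1:] ^ (s + t - 4) dvd char_poly (distance_matrix (s + t) (Kst s t))"
proof -
  let ?n = "s + t"
  have "[:1, 1:] ^ 4 * char_poly (distance_matrix ?n (Kst s t)) = [:1, 1:] ^ ?n *
    pcompose (char_poly (quotient_mat 4 (\<lambda>i j. real (entry P4_rows i j)) ?n (Kst_class s))) [:1, 1:]"
    using Kst_distance_matrix[OF st]
    by (intro char_poly_blowup) (auto simp: distance_matrix_def Kst_class_def)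
  moreover have "[:1, 1 :: real:] ^ ?n = [:1, 1:] ^ 4 * [:1, 1:] ^ (?n - 4)"
    using st by (simp flip: power_add)
  ultimately have "[:1, 1:] ^ 4 * char_poly (distance_matrix ?n (Kst s t)) = [:1, 1:] ^ 4 * ([:1, 1:] ^ (?n - 4) *
    pcompose (char_poly (quotient_mat 4 (\<lambda>i j. real (entry P4_rows i j)) ?n (Kst_class s))) [:1, 1:])"
    by (simp add: mult.assoc)
  then show ?thesis by (subst (asm) mult_left_cancel) auto
qed

theorem theorem3p4:
  fixes s t m :: nat and F :: "nat \<Rightarrow> nat \<Rightarrow> bool"
  assumes "s \<ge> 2" and "t \<ge> 2"
    and "simple_graph m F" and "connected_graph m F"
    and "D_spectrum m F = D_spectrum (s + t) (Kst s t)"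
  shows "graph_iso m F (s + t) (Kst s t)"
proof -
  note st = assms(1,2)
  let ?n = "s + t" and ?\<psi> = "Kst_class s"
  have m: "m = ?n" and cp: "char_poly (distance_matrix ?n F) = char_poly (distance_matrix ?n (Kst s t))"
    using D_spectrum_eq_imp_char_poly_eq[OF assms(5)] by auto
  \<comment> \<open>The eigenvalue \<open>-1\<close> carries over to \<open>F\<close> with its
    multiplicity, as the characteristic polynomials agree.\<close>
  interpret rank4_graph ?n F
    using assms(3,4) Kst_eigenvalue_minus_1[OF st] unfolding cp[symmetric] m by unfold_locales
  define p q where "p = int (s - 1)" "q = int (t - 1)"
  have pq: "p \<ge> 1" "q \<ge> 1" using st by (auto simp: p_q_def)
  have \<psi>4: "?\<psi> u < 4" for u by (simp add: Kst_class_def)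
  have \<psi>: "real (class_size ?n ?\<psi> 0) = p" "real (class_size ?n ?\<psi> 1) = 1"
    "real (class_size ?n ?\<psi> 2) = 1" "real (class_size ?n ?\<psi> 3) = q"
    using class_size_Kst_class[OF st] by (simp_all add: p_q_def)
  have Kst_poly: "poly (char_poly (quotient_mat 4 (\<lambda>i j. real (entry P4_rows i j)) ?n ?\<psi>)) x
    = x ^ 4 - (p + 1 + 1 + q) * x ^ 3 - (3 * p + 3 * q + 8 * p * q) * x ^ 2 + (p + q + 2 * p * q) * x + p * q" for x :: real
    unfolding char_poly_quotient_P4 Let_def \<psi> by (simp add: algebra_simps)
  \<comment> \<open>This reduces cospectrality to an equality of quartics in the class sizes,
    whichever matrix \<open>R\<close> describes \<open>F\<close>.\<close>
  have quotient: "char_poly (quotient_mat 4 (\<lambda>i j. real (entry R i j)) ?n \<phi>)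
      = char_poly (quotient_mat 4 (\<lambda>i j. real (entry P4_rows i j)) ?n ?\<psi>)"
    if "\<And>u. u < ?n \<Longrightarrow> \<phi> u < 4" "\<And>u v. u < ?n \<Longrightarrow> v < ?n \<Longrightarrow> dist1 u v = entry R (\<phi> u) (\<phi> v)" for R \<phi>
    using that distance_matrix_dist1 Kst_distance_matrix[OF st] cp
    by (intro char_poly_quotient_mat_eq[of "distance_matrix ?n F" _ _ _ _ "distance_matrix ?n (Kst s t)"])
       (auto simp: distance_matrix_def Kst_class_def)
  show ?thesis
  proof (cases "\<exists>x<?n. \<exists>y<?n. d x y \<ge> 3")
    case False
    have diam: "dist1 u v \<in> {1, 2}" if "u < ?n" "v < ?n" for u v
    proof -
      have "\<not> d u v \<ge> 3" using False that by blast
      then show ?thesis using dist1_pos[OF that] by (auto simp: dist1_def split: if_splits)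
    qed
    obtain R \<phi> where R: "R = K13_rows \<or> R = C4_rows" and \<phi>: "\<And>u. u < ?n \<Longrightarrow> \<phi> u < 4"
      "\<And>u v. u < ?n \<Longrightarrow> v < ?n \<Longrightarrow> dist1 u v = entry R (\<phi> u) (\<phi> v)"
      using diameter_2_classification[OF diam] by blast
    define N where "N i = int (class_size ?n \<phi> i)" for i
    have cs: "real (class_size ?n \<phi> i) = N i" for i by (simp add: N_def)
    have N: "N i \<ge> 0" for i by (simp add: N_def)
    have eq: "poly (char_poly (quotient_mat 4 (\<lambda>i j. real (entry R i j)) ?n \<phi>)) x
        = poly (char_poly (quotient_mat 4 (\<lambda>i j. real (entry P4_rows i j)) ?n ?\<psi>)) x" for x
      using quotient[OF \<phi>] by simp
    from R show ?thesis
    proof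
      assume K13: "R = K13_rows"
      note coeffs = quartic_coefficients[OF eq[unfolded K13 Kst_poly char_poly_quotient_K13 Let_def cs]]
      have "3 * N 1 * N 2 + 3 * N 1 * N 3 + 3 * N 2 * N 3 = 3 * p + 3 * q + 8 * p * q"
        and "2 * N 0 * N 1 * N 2 * N 3 = p * q"
        using coeffs(2,4) unfolding of_int_eq_iff[where 'a = real, symmetric] by simp_all
      from K13_sizes[OF N N N N pq this] show ?thesis ..
    next
      assume C4: "R = C4_rows"
      note coeffs = quartic_coefficients[OF eq[unfolded C4 Kst_poly char_poly_quotient_C4 Let_def cs]]
      have "3 * N 0 * N 2 + 3 * N 1 * N 3 = 3 * p + 3 * q + 8 * p * q"
        and "5 * N 0 * N 1 * N 2 * N 3 = p * q"
        using coeffs(2,4) unfolding of_int_eq_iff[where 'a = real, symmetric] by simp_all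
      from C4_sizes[OF N N N N pq this] show ?thesis ..
    qed
  next
    case True
    then obtain x y where "x < ?n" and y: "y < ?n" and "d x y \<ge> 3" by blast
    from isometric_path[OF this] obtain p' q' r' where a: "p' < ?n" "q' < ?n" "r' < ?n" "y < ?n"
      and D: "d p' q' = 1" "d q' r' = 1" "d r' y = 1" "d p' r' = 2" "d q' y = 2" "d p' y = 3"
      using y by metis
    have B: "dist1 p' q' = 1" "dist1 q' r' = 1" "dist1 r' y = 1" "dist1 p' r' = 2" "dist1 q' y = 2" "dist1 p' y = 3"
      using D by (auto simp: dist1_def)
    have entries: "dist1 ([p', q', r', y] ! i) ([p', q', r', y] ! j) = entry P4_rows i j" if "i < 4" "j < 4" for i j
      using that B dist1_sym a by (auto simp: less_4_cases entry_def P4_rows_def)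
    obtain \<phi> where \<phi>: "\<And>u. u < ?n \<Longrightarrow> \<phi> u < 4"
        "\<And>u v. u < ?n \<Longrightarrow> v < ?n \<Longrightarrow> dist1 u v = entry P4_rows (\<phi> u) (\<phi> v)"
      using blowup_of_rows[OF a rows_of_isometric_P4[OF a D] entries] by blast
    define N where "N i = int (class_size ?n \<phi> i)" for i
    have cs: "real (class_size ?n \<phi> i) = N i" for i by (simp add: N_def)
    have eq: "poly (char_poly (quotient_mat 4 (\<lambda>i j. real (entry P4_rows i j)) ?n \<phi>)) x
        = poly (char_poly (quotient_mat 4 (\<lambda>i j. real (entry P4_rows i j)) ?n ?\<psi>)) x" for x
      using quotient[OF \<phi>] by simp
    note coeffs = quartic_coefficients[OF eq[unfolded char_poly_quotient_P4 Let_def cs \<psi>]]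
    have e: "N 0 + N 1 + N 2 + N 3 = p + q + 2"
      "3 * N 0 * N 2 + 3 * N 1 * N 3 + 8 * N 0 * N 3 = 3 * p + 3 * q + 8 * p * q"
      "N 0 * N 1 * N 2 + N 0 * N 1 * N 3 + N 0 * N 2 * N 3 + N 1 * N 2 * N 3 = p + q + 2 * p * q"
      "N 0 * N 1 * N 2 * N 3 = p * q"
      using coeffs unfolding of_int_eq_iff[where 'a = real, symmetric] by (simp_all add: algebra_simps)
    have "p * q > 0" using pq by simp
    with e(4) have "N i \<noteq> 0" if "i < 4" for i using that by (auto simp: less_4_cases)
    then have N: "N i \<ge> 1" if "i < 4" for i using that by (fastforce simp: N_def)
    have sizes: "N 1 = 1 \<and> N 2 = 1 \<and> (N 0 = p \<and> N 3 = q \<or> N 0 = q \<and> N 3 = p)"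
      by (rule P4_sizes[OF N N N N e]) simp_all
    have adj: "F u v \<longleftrightarrow> u \<noteq> v \<and> entry P4_rows (\<phi> u) (\<phi> v) = 1" if "u < ?n" "v < ?n" for u v
      using E_iff_dist1[OF that] \<phi>(2)[OF that] by simp
    show ?thesis
    proof (cases "N 0 = p \<and> N 3 = q")
      case True
      then have size: "class_size ?n \<phi> i = class_size ?n ?\<psi> i" if "i < 4" for i
        using that sizes class_size_Kst_class[OF st]
        by (auto simp: less_4_cases N_def p_q_def)
      show ?thesis
        unfolding m
        by (rule graph_iso_of_blowups[where k = 4 and P = "\<lambda>i j. entry P4_rows i j = 1",
            OF \<phi>(1) \<psi>4 size adj Kst_iff_class[OF st]])
    next
      case False
      \<comment> \<open>The end classes have exchanged sizes, so the path is read from its other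
        end; \<open>P4_rows\<close> is invariant under this reversal.\<close>
      define \<phi>' where "\<phi>' u = 3 - \<phi> u" for u
      have reverse: "class_size ?n \<phi>' i = class_size ?n \<phi> (3 - i)" if "i < 4" for i
      proof -
        have "\<phi>' u = i \<longleftrightarrow> \<phi> u = 3 - i" if "u < ?n" for u
          using \<phi>(1)[OF that] \<open>i < 4\<close> unfolding \<phi>'_def by linarith
        then have "{u. u < ?n \<and> \<phi>' u = i} = {u. u < ?n \<and> \<phi> u = 3 - i}" by blast
        then show ?thesis by (simp add: class_size_def)
      qed
      have sizes': "class_size ?n \<phi> 0 = t - 1" "class_size ?n \<phi> 1 = 1" "class_size ?n \<phi> 2 = 1"
        "class_size ?n \<phi> 3 = s - 1"
        using sizes False by (auto simp: N_def p_q_def)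
      have size: "class_size ?n \<phi>' i = class_size ?n ?\<psi> i" if "i < 4" for i
        using that unfolding less_4_cases
        by (elim disjE) (simp_all add: reverse sizes' sizes'[unfolded One_nat_def] class_size_Kst_class[OF st]
            class_size_Kst_class[OF st, unfolded One_nat_def])
      have "entry P4_rows (3 - i) (3 - j) = entry P4_rows i j" if "i < 4" "j < 4" for i j
        using that by (auto simp: less_4_cases entry_def P4_rows_def)
      then have adj': "F u v \<longleftrightarrow> u \<noteq> v \<and> entry P4_rows (\<phi>' u) (\<phi>' v) = 1" if "u < ?n" "v < ?n" for u v
        unfolding adj[OF that] \<phi>'_def using \<phi>(1)[OF that(1)] \<phi>(1)[OF that(2)] by simp
      have \<phi>'4: "\<phi>' u < 4" for u by (simp add: \<phi>'_def)
      show ?thesis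
        unfolding m
        by (rule graph_iso_of_blowups[where k = 4 and P = "\<lambda>i j. entry P4_rows i j = 1",
            OF \<phi>'4 \<psi>4 size adj' Kst_iff_class[OF st]])
    qed
  qed
qed

end
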